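(* Let $\mathrm{Im}(t')>0$. For $k\in\mathbb Z$ let $l'_k=\mathbb R_{<0}\cdot2\pi \mathrm i(t'+k)$, and let $\rho_k$ be a ray in the sector between $l'_k$ and $l'_{k-1}$. For $\lambda'\in\mathbb H_{\pm\rho_k}$ let $$F'_{\pm\rho_k}(\lambda',t')=-\frac{1}{(2\pi)^2\lambda'}\big(2\mathrm{Li}_3(Q')-2\pi \mathrm i t'\,\mathrm{Li}_2(Q')\big)-\frac{\mathrm i}{4\pi}\big(\mathrm{Li}_2(Q')-2\pi \mathrm i t'\,\mathrm{Li}_1(Q')\big)+\int_{\pm\rho_k}dv\,e^{-v/\lambda'}G_{\mathrm s}(v,t'),$$ where $Q'=e^{2\pi \mathrm i t'}$ and $$G_{\mathrm s}(v,t')=\frac{1}{(2\pi)^2}\sum_{n\in\mathbb Z\setminus\{0\}}\frac{1}{n^3}\,\frac{v+2\pi \mathrm i nt'}{1-e^{-v/n-2\pi \mathrm i t'}}.$$ Put $\lambda=2\pi/\lambda'$, $t=t'/\lambda'$, $Q=e^{2\pi \mathrm i t}$, $q=e^{\mathrm i\lambda}$. Then on the overlap of the domains of definition in $\lambda'$ the Stokes jump across $\pm l'_k$ is $$F'_{\pm\rho_{k+1}}(\lambda',t')-F'_{\pm\rho_k}(\lambda',t')=\mp k\log\big(1-Q^{\pm1}q^{\pm k}\big)\qquad(k\in\mathbb Z);$$ in particular there is no jump for $k=0$. Moreover, assume $0<\mathrm{Re}(t')<1$ and that $\lambda'$ lies in the common domain of definition of the functions involved. If $\mathrm{Im}(\lambda')>0$,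 then $$\lim_{k\to-\infty}F'_{\rho_k}(\lambda',t')-F'_{\rho_0}(\lambda',t')=-\sum_{k=1}^\infty k\log(1-Qq^{-k})=-\sum_{k=1}^\infty\frac1k\frac{e^{2\pi \mathrm i kt}}{\big(2\sin(k\lambda/2)\big)^2},$$ and if $\mathrm{Im}(\lambda')<0$, then $$\lim_{k\to\infty}F'_{\rho_k}(\lambda',t')-F'_{\rho_0}(\lambda',t')=-\sum_{k=1}^\infty k\log(1-Qq^{k})=-\sum_{k=1}^\infty\frac1k\frac{e^{2\pi \mathrm i kt}}{\big(2\sin(k\lambda/2)\big)^2}.$$
   Context: $\mathrm{Li}_s(z)=\sum_{n\ge1}z^n/n^s$. A ray goes from $0$ to $\infty$ in $\mathbb C$; $\mathbb H_\rho$ is the open half-plane centered at $\rho$; $-\rho$ is the opposite ray; the sector between two rays is the convex open sector they bound. The logarithms are principal (their arguments are of the form $1-x$ with $|x|<1$ on the domains considered). *)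

theory Defs
  imports "HOL-Analysis.Analysis"
begin

definition Li :: "nat \<Rightarrow> complex \<Rightarrow> complex" where
  "Li s z = (\<Sum>n. z ^ Suc n / of_nat (Suc n) ^ s)"

text \<open>A ray from \<open>0\<close> to \<open>\<infinity>\<close> is represented by a nonzero direction vector \<open>d\<close>; all notions
  below are invariant under rescaling \<open>d\<close> by a positive real. The opposite ray has direction
  \<open>- d\<close>, and a ray lies in a sector iff its direction vector does.\<close>

definition ray :: "complex \<Rightarrow> complex set" where
  "ray d = {of_real r * d | r. r > 0}"

definition half_plane :: "complex \<Rightarrow> complex set" where
  "half_plane d = {z. Re (z * cnj d) > 0}"

definition sector :: "complex \<Rightarrow> complex \<Rightarrow> complex set" where
  "sector d e = {of_real a * d + of_real b * e | a b. a > 0 \<and> b > 0}"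

definition ray_integrable :: "complex \<Rightarrow> (complex \<Rightarrow> complex) \<Rightarrow> bool" where
  "ray_integrable d f \<longleftrightarrow> set_integrable lborel {0<..} (\<lambda>r. f (of_real r * d) * d)"

definition ray_integral :: "complex \<Rightarrow> (complex \<Rightarrow> complex) \<Rightarrow> complex" where
  "ray_integral d f = (LINT r:{0<..}|lborel. f (of_real r * d) * d)"

text \<open>Direction of \<open>l'\<^sub>k\<close>, the set of negative real multiples of \<open>2 \<pi> i (t' + k)\<close>.\<close>

definition l_dir :: "complex \<Rightarrow> int \<Rightarrow> complex" where
  "l_dir t' k = - (2 * of_real pi * \<i> * (t' + of_int k))"

text \<open>The denominators of \<open>Gs\<close> vanish only for \<open>v\<close> on some \<open>\<plusminus> l'\<^sub>k\<close>; the integration rays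
  avoid these, so that the convention \<open>x / 0 = 0\<close> plays no role.\<close>

definition Gs_term :: "complex \<Rightarrow> complex \<Rightarrow> int \<Rightarrow> complex" where
  "Gs_term v t' n = 1 / of_int n ^ 3 *
     ((v + 2 * of_real pi * \<i> * of_int n * t') /
      (1 - exp (- v / of_int n - 2 * of_real pi * \<i> * t')))"

definition Gs :: "complex \<Rightarrow> complex \<Rightarrow> complex" where
  "Gs v t' = 1 / (2 * of_real pi) ^ 2 * (\<Sum>\<^sub>\<infinity>n\<in>UNIV - {0}. Gs_term v t' n)"

definition F' :: "complex \<Rightarrow> complex \<Rightarrow> complex \<Rightarrow> complex" where
  "F' d lam' t' =
    (let Q' = exp (2 * of_real pi * \<i> * t') in
      - 1 / ((2 * of_real pi) ^ 2 * lam') * (2 * Li 3 Q' - 2 * of_real pi * \<i> * t' * Li 2 Q')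
      - \<i> / (4 * of_real pi) * (Li 2 Q' - 2 * of_real pi * \<i> * t' * Li 1 Q')
      + ray_integral d (\<lambda>v. exp (- v / lam') * Gs v t'))"

end

theory Submission
  imports Defs "HOL-Complex_Analysis.Complex_Analysis"
begin

text \<open>With \<open>\<phi>(w) = w / (1 - exp (- w))\<close> the \<open>n\<close>-th term of the series defining \<open>G\<^sub>s\<close> is
  \<open>\<phi>(v/n + 2\<pi>it') / n\<^sup>2\<close>. Along a ray it is \<open>O((1 + |v|) / n\<^sup>2)\<close>, so the Laplace integral of
  \<open>G\<^sub>s\<close> can be computed term by term. Rotating the ray across \<open>l'\<^sub>k\<close>, the \<open>n\<close>-th term only meets
  the simple pole \<open>v = n l'\<^sub>k\<close>, and only if \<open>n\<close> has the sign of the side considered; Cauchy's formula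
  on a large triangle shows that the integral changes by a multiple of \<open>(k/n) (Q q\<^sup>k)\<^sup>n\<close>, and the
  sum over \<open>n\<close> is a logarithmic series. The limits follow by telescoping, and expanding the logarithms
  yields a Lambert double series, whose summation in the other order gives the \<open>sin\<close> form.\<close>

subsection \<open>The summands of the integrand\<close>

text \<open>For a fixed sign of n, the points n l'_k lie on one ray and tend to infinity, so a
  growing contour for the whole sum would meet more and more poles. For a single n there is one pole
  to catch, and the radius from which the triangles are used may depend on n; only the bounds on the
  rays themselves have to be uniform in n. They are, because n enters \<open>phi\<close> only
  through v/n: along one ray all arguments lie on one fixed line, and both halves of it occur since
  n takes both signs. The factor k of the jump comes from the numerator: at v/n = l'_k the quantity
  v/n + 2 pi i t' equals -2 pi i k. Times 2 pi i this is (2 pi)^2 k, and the square cancels the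
  normalisation of \<open>Gs\<close>. Both signs of the ray are carried by an integer s with |s| =
  1.\<close>

definition phi :: "complex \<Rightarrow> complex" where
  "phi w = w / (1 - exp (- w))"

text \<open>The value 1 fills the removable singularity at 0, where \<open>phi\<close> itself is 0
  by the convention for division by zero.\<close>

definition psi :: "complex \<Rightarrow> complex" where
  "psi z = (if z = 0 then 1 else phi z)"

lemma Gs_term_eq_phi:
  assumes "n \<noteq> 0"
  shows "Gs_term v t' n = phi (v / of_int n + 2 * of_real pi * \<i> * t') / of_int n ^ 2"
proof -
  have "v + 2 * of_real pi * \<i> * of_int n * t' = of_int n * (v / of_int n + 2 * of_real pi * \<i> * t')"
    using assms by (simp add: field_simps)
  moreover have "1 - exp (- v / of_int n - 2 * of_real pi * \<i> * t')
      = 1 - exp (- (v / of_int n + 2 * of_real pi * \<i> * t'))"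
    by simp
  ultimately show ?thesis
    using assms by (simp only: Gs_term_def phi_def) (simp add: power2_eq_square power3_eq_cube)
qed

text \<open>\<open>psi\<close> is the reciprocal of the difference quotient of 1 - exp (-z) at 0,
  which becomes entire once completed by its derivative there. The zeros of that entire function are
  the nonzero solutions of exp (-z) = 1, which the hypothesis keeps out of S.\<close>

lemma psi_holomorphic:
  assumes "\<And>z. z \<in> S \<Longrightarrow> exp (- z) = 1 \<Longrightarrow> z = 0"
  shows "psi holomorphic_on S"
proof -
  let ?f = "\<lambda>z. 1 - exp (- z) :: complex"
  let ?F = "\<lambda>z. if z = 0 then deriv ?f 0 else (?f z - ?f 0) / (z - 0)"
  have "?F holomorphic_on UNIV"
    by (rule pole_lemma) (auto intro!: holomorphic_intros)
  then have hol: "?F holomorphic_on S"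
    by (rule holomorphic_on_subset) auto
  have d: "deriv ?f 0 = 1"
    by (rule DERIV_imp_deriv) (auto intro!: derivative_eq_intros)
  have "?F z \<noteq> 0" if "z \<in> S" for z
    using assms[OF that] d by auto
  then have "(\<lambda>z. 1 / ?F z) holomorphic_on S"
    by (intro holomorphic_on_divide hol holomorphic_intros)
  moreover have "psi = (\<lambda>z. 1 / ?F z)"
    unfolding psi_def phi_def d by auto
  ultimately show ?thesis by simp
qed

lemma exp_shift_l_dir: "exp (- (u + 2 * of_real pi * \<i> * t')) = exp (- (u - l_dir t' k))"
proof -
  have "- (u + 2 * of_real pi * \<i> * t') = - (u - l_dir t' k) + \<i> * (of_int (2 * k) * (of_real pi))"
    by (simp add: l_dir_def algebra_simps)
  also have "exp \<dots> = exp (- (u - l_dir t' k))"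
    by (subst exp_plus_2pin [symmetric, of _ k]) (simp add: algebra_simps)
  finally show ?thesis .
qed

text \<open>In the variable u = v/n, the possible singularities of every term are thus the same
  points, independent of n.\<close>

lemma exp_l_dir_eq_1_iff:
  "exp (- (u + 2 * of_real pi * \<i> * t')) = 1 \<longleftrightarrow> (\<exists>j. u = l_dir t' j)"
proof
  assume "exp (- (u + 2 * of_real pi * \<i> * t')) = 1"
  then obtain n :: int where "Re (- (u + 2 * of_real pi * \<i> * t')) = 0"
    "Im (- (u + 2 * of_real pi * \<i> * t')) = of_int (2 * n) * pi"
    unfolding exp_eq_1 by blast
  then have "u = l_dir t' n"
    by (intro complex_eqI) (auto simp: l_dir_def algebra_simps)
  then show "\<exists>j. u = l_dir t' j" ..
next
  assume "\<exists>j. u = l_dir t' j"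
  then obtain j where "u = l_dir t' j" ..
  then show "exp (- (u + 2 * of_real pi * \<i> * t')) = 1"
    using exp_shift_l_dir[of u t' j] by simp
qed

text \<open>At \<open>k = 0\<close> the first factor of the numerator vanishes together with the denominator, so that
  the absence of a jump there needs no separate treatment.\<close>

lemma phi_shift_eq:
  assumes "u \<noteq> l_dir t' k"
  shows "phi (u + 2 * of_real pi * \<i> * t')
    = (u + 2 * of_real pi * \<i> * t') * psi (u - l_dir t' k) / (u - l_dir t' k)"
  using assms unfolding psi_def phi_def exp_shift_l_dir[of u t' k] by auto

text \<open>Outside the strip |Re w| < 1, exp (-w) has norm at most 1/e or at least e, so it stays
  at distance at least 1/2 from 1.\<close>

lemma norm_phi_le:
  assumes "1 \<le> \<bar>Re w\<bar>"
  shows "norm (phi w) \<le> 2 * norm w"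
proof -
  have e: "exp 1 \<ge> (2::real)" using exp_ge_add_one_self[of 1] by simp
  have "1 / 2 \<le> norm (1 - exp (- w))"
  proof (cases "Re w \<ge> 0")
    case True
    then have "norm (exp (- w)) \<le> exp (- 1)" using assms by (simp add: norm_exp_eq_Re)
    also have "\<dots> \<le> 1 / 2" using e by (simp add: exp_minus field_simps)
    finally show ?thesis using norm_triangle_ineq2[of 1 "exp (- w)"] by simp
  next
    case False
    then have "exp 1 \<le> norm (exp (- w))" using assms by (simp add: norm_exp_eq_Re)
    moreover have "norm (exp (- w)) - 1 \<le> norm (1 - exp (- w))"
      using norm_triangle_ineq2[of "exp (- w)" 1] by (simp add: norm_minus_commute)
    ultimately show ?thesis using e by linarith
  qed
  then have "norm w / norm (1 - exp (- w)) \<le> norm w / (1 / 2)"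
    by (intro divide_left_mono) auto
  then show ?thesis by (simp add: phi_def norm_divide)
qed

section \<open>Position of directions relative to the rays l'_k\<close>

text \<open>The sign of \<open>side t' d m\<close> tells on which side of \<open>l'\<^sub>m\<close> the direction \<open>d\<close> lies, for \<open>Re d > 0\<close>.\<close>

definition side :: "complex \<Rightarrow> complex \<Rightarrow> int \<Rightarrow> real" where
  "side t' d m = Re d * (Re t' + of_int m) + Im t' * Im d"

lemma Re_l_dir [simp]: "Re (l_dir t' k) = 2 * pi * Im t'"
  by (simp add: l_dir_def)

lemma Im_l_dir [simp]: "Im (l_dir t' k) = - 2 * pi * (Re t' + of_int k)"
  by (simp add: l_dir_def)

lemma side_l_dir: "side t' (l_dir t' k) m = 2 * pi * Im t' * (of_int m - of_int k)"
  by (simp add: side_def algebra_simps)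

lemma side_add_scale:
  "side t' (of_real x * d + of_real y * e) m = x * side t' d m + y * side t' e m"
  by (simp add: side_def algebra_simps)

lemma side_scale: "side t' (of_real x * d) m = x * side t' d m"
  by (simp add: side_def algebra_simps)

lemma side_mono:
  assumes "Re d \<ge> 0" "m \<le> m'"
  shows "side t' d m \<le> side t' d m'"
  using assms by (simp add: side_def mult_left_mono)

text \<open>\<open>side t' d m\<close> is the determinant of \<open>l_dir t' m\<close> and d,
  divided by 2 pi. It is linear in d, so its sign on the sector can be read off from the two edges:
  each edge gives 0 at its own index, and the other edge decides.\<close>

lemma sector_sides:
  assumes "Im t' > 0" "d \<in> sector (l_dir t' k) (l_dir t' (k - 1))"
  shows "Re d > 0" "side t' d k > 0" "side t' d (k - 1) < 0"
proof -
  obtain a b where ab: "a > 0" "b > 0" "d = of_real a * l_dir t' k + of_real b * l_dir t' (k - 1)"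
    using assms(2) by (auto simp: sector_def)
  show "Re d > 0" using ab assms(1) by (simp add: add_pos_pos)
  show "side t' d k > 0" "side t' d (k - 1) < 0"
    unfolding ab(3) side_add_scale side_l_dir using ab assms(1) by (auto simp: mult_pos_neg)
qed

text \<open>A multiple of d equal to l'_j would force x times \<open>side t' d j\<close> to vanish.
  But \<open>side\<close> increases with the index and changes sign strictly between k - 1 and k, so
  it is never 0 on d. The whole line is treated, not only the ray, because v/n changes half when n
  changes sign.\<close>

lemma line_avoids_l_dir:
  assumes "Im t' > 0" "d \<in> sector (l_dir t' k) (l_dir t' (k - 1))"
  shows "of_real x * d \<noteq> l_dir t' j"
proof
  assume eq: "of_real x * d = l_dir t' j"
  note s = sector_sides[OF assms]
  have "x * side t' d j = 0"
    using side_l_dir[of t' j j] by (simp add: eq[symmetric] side_scale)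
  moreover have "side t' d j \<noteq> 0"
    using side_mono[of d k j t'] side_mono[of d j "k - 1" t'] s by (cases "k \<le> j") auto
  ultimately have "x = 0" by simp
  then have "l_dir t' j = 0" using eq by simp
  then have "Re (l_dir t' j) = 0" by simp
  then show False using assms(1) by simp
qed

lemma l_dir_between:
  assumes t': "Im t' > 0"
    and d: "d \<in> sector (l_dir t' k) (l_dir t' (k - 1))"
    and e: "e \<in> sector (l_dir t' (k + 1)) (l_dir t' k)"
  obtains a b where "a > 0" "b > 0" "l_dir t' k = of_real a * d + of_real b * e"
proof -
  note sd = sector_sides[OF t' d]
  have se: "Re e > 0" "side t' e k < 0" using sector_sides[OF t', of e "k + 1"] e by simp_all
  \<comment> \<open>The weights -\<open>side t' e k\<close> and \<open>side t' d k\<close> are the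
    ones that cancel \<open>side\<close> at index k, which puts the combination on the line through
    l'_k. \<open>T\<close> is its real part, and \<tau> rescales that to 2 pi Im t', the real part
    of l'_k.\<close>
  define T where "T = side t' d k * Re e - side t' e k * Re d"
  have T: "T > 0" unfolding T_def using sd se by (smt (verit) mult_pos_pos mult_neg_pos)
  define \<tau> where "\<tau> = 2 * pi * Im t' / T"
  have \<tau>: "\<tau> > 0" using T t' by (simp add: \<tau>_def)
  define a b where "a = - side t' e k * \<tau>" "b = side t' d k * \<tau>"
  have ab: "a > 0" "b > 0" using sd se \<tau> by (simp_all add: a_b_def mult_neg_pos)
  let ?z = "of_real a * d + of_real b * e"
  have "Re ?z = \<tau> * T" by (simp add: a_b_def T_def algebra_simps)
  then have re: "Re ?z = 2 * pi * Im t'" using T by (simp add: \<tau>_def)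
  have "side t' ?z k = 0" unfolding side_add_scale by (simp add: a_b_def)
  then have "Im t' * Im ?z = Im t' * (- 2 * pi * (Re t' + of_int k))"
    unfolding side_def re by (simp add: algebra_simps)
  then have "Im ?z = - 2 * pi * (Re t' + of_int k)"
    using t' by (subst (asm) mult_left_cancel) auto
  then have "l_dir t' k = ?z" using re by (intro complex_eqI) simp_all
  with ab show thesis by (rule that)
qed

text \<open>At index k + 1 \<open>side\<close> is positive on both edges of the cone, at index k - 1
  negative on both. Evaluated on l'_j this gives j < k + 1 and j > k - 1. The closed cone is needed
  because holomorphy is later required on a closed triangle; its apex is excluded by Re l'_j >
  0.\<close>

lemma l_dir_in_cone_unique:
  assumes t': "Im t' > 0"
    and d: "d \<in> sector (l_dir t' k) (l_dir t' (k - 1))"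
    and e: "e \<in> sector (l_dir t' (k + 1)) (l_dir t' k)"
    and xy: "x \<ge> 0" "y \<ge> 0" "of_real x * d + of_real y * e = l_dir t' j"
  shows "j = k"
proof -
  note sd = sector_sides[OF t' d]
  have se: "Re e > 0" "side t' e k < 0" "side t' e (k + 1) > 0"
    using sector_sides[OF t', of e "k + 1"] e by simp_all
  have sd': "side t' d (k + 1) > 0" using side_mono[of d k "k + 1" t'] sd by simp
  have se': "side t' e (k - 1) < 0" using side_mono[of e "k - 1" k t'] se by simp
  have nz: "x > 0 \<or> y > 0"
  proof (rule ccontr)
    assume "\<not> ?thesis"
    then have "l_dir t' j = 0" using xy by (simp add: antisym)
    then have "Re (l_dir t' j) = 0" by simp
    then show False using t' by simp
  qed
  have pos: "0 < x * p + y * q" if "p > 0" "q > 0" for p q :: real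
  proof -
    have "0 \<le> x * p" "0 \<le> y * q" using xy(1,2) that by simp_all
    moreover have "0 < x * p \<or> 0 < y * q" using nz that by auto
    ultimately show ?thesis by linarith
  qed
  have 1: "x * side t' d m + y * side t' e m = 2 * pi * Im t' * (of_int m - of_int j)" for m
    using side_l_dir[of t' j m] unfolding xy(3)[symmetric] side_add_scale .
  have "0 < 2 * pi * Im t' * (of_int (k + 1) - of_int j)"
    unfolding 1[symmetric] by (rule pos[OF sd' se(3)])
  then have "(0::real) < of_int (k + 1) - of_int j"
    by (rule zero_less_mult_pos) (use t' in simp)
  then have jk: "j \<le> k" by linarith
  have "0 < x * (- side t' d (k - 1)) + y * (- side t' e (k - 1))"
    using se' sd(3) by (intro pos) auto
  also have "\<dots> = 2 * pi * Im t' * (of_int j - of_int (k - 1))"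
    using 1[of "k - 1"] by (simp add: algebra_simps)
  finally have "(0::real) < of_int j - of_int (k - 1)"
    by (rule zero_less_mult_pos) (use t' in simp)
  then show ?thesis using jk by linarith
qed

text \<open>So e lies clockwise from d. This makes the triangle 0, R e, R d nondegenerate and
  counterclockwise, which fixes the sign of the jump.\<close>

lemma Im_mult_cnj_sectors:
  assumes t': "Im t' > 0"
    and d: "d \<in> sector (l_dir t' k) (l_dir t' (k - 1))"
    and e: "e \<in> sector (l_dir t' (k + 1)) (l_dir t' k)"
  shows "Im (e * cnj d) < 0"
proof -
  note sd = sector_sides[OF t' d]
  have se: "Re e > 0" "side t' e k < 0" using sector_sides[OF t', of e "k + 1"] e by simp_all
  have "Im t' * Im (e * cnj d) = Re d * side t' e k - Re e * side t' d k"
    by (simp add: side_def algebra_simps)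
  also have "\<dots> < 0" using sd se by (smt (verit) mult_pos_pos mult_pos_neg)
  finally show ?thesis using t' by (simp add: mult_less_0_iff)
qed

section \<open>Growth of the terms along a line\<close>

lemma phi_line_bound:
  assumes t': "Im t' > 0" and d: "d \<in> sector (l_dir t' k) (l_dir t' (k - 1))"
  obtains C where "C \<ge> 0"
    "\<And>x::real. norm (phi (of_real x * d + 2 * of_real pi * \<i> * t')) \<le> C * (1 + \<bar>x\<bar>)"
proof -
  have Re: "Re d > 0" using sector_sides[OF t' d] by simp
  let ?h = "\<lambda>x::real. phi (of_real x * d + 2 * of_real pi * \<i> * t')"
  \<comment> \<open>Since Re (2 pi i t') = -2 pi Im t', this is the length beyond which the argument
    of \<open>phi\<close> has left the strip of \<open>norm_phi_le\<close>. On the remaining compact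
    interval continuity suffices.\<close>
  define X where "X = (1 + 2 * pi * Im t') / Re d"
  have "continuous_on {-X..X} ?h"
    unfolding phi_def
  proof (intro continuous_intros ballI)
    fix x :: real
    have "exp (- (of_real x * d + 2 * of_real pi * \<i> * t')) \<noteq> 1"
      unfolding exp_l_dir_eq_1_iff using line_avoids_l_dir[OF t' d] by blast
    then show "1 - exp (- (of_real x * d + 2 * of_real pi * \<i> * t')) \<noteq> 0" by simp
  qed
  then have "bounded (?h ` {-X..X})"
    by (intro compact_imp_bounded compact_continuous_image) auto
  then obtain B where B: "B > 0" "\<And>x. x \<in> {-X..X} \<Longrightarrow> norm (?h x) \<le> B"
    by (auto simp: bounded_pos)
  define C where "C = B + 2 * norm d + 2 * norm (2 * of_real pi * \<i> * t')"
  have C0: "C \<ge> 0" using B by (simp add: C_def)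
  have "norm (?h x) \<le> C * (1 + \<bar>x\<bar>)" for x
  proof (cases "x \<in> {-X..X}")
    case True
    have "C * 1 \<le> C * (1 + \<bar>x\<bar>)" using C0 by (intro mult_left_mono) auto
    moreover have "B \<le> C" by (simp add: C_def)
    ultimately show ?thesis using B(2)[OF True] by linarith
  next
    case False
    then have "\<bar>x\<bar> \<ge> X" by auto
    then have "\<bar>x * Re d\<bar> \<ge> 1 + 2 * pi * Im t'"
      using Re by (simp add: X_def abs_mult field_simps)
    moreover have "2 * pi * Im t' \<ge> 0" using t' by simp
    moreover have "Re (of_real x * d + 2 * of_real pi * \<i> * t') = x * Re d - 2 * pi * Im t'" by simp
    ultimately have "1 \<le> \<bar>Re (of_real x * d + 2 * of_real pi * \<i> * t')\<bar>" by arith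
    then have "norm (?h x) \<le> 2 * norm (of_real x * d + 2 * of_real pi * \<i> * t')" by (rule norm_phi_le)
    also have "\<dots> \<le> 2 * (\<bar>x\<bar> * norm d + norm (2 * of_real pi * \<i> * t'))"
      by (intro mult_left_mono order.trans[OF norm_triangle_ineq]) (auto simp: norm_mult)
    also have "\<dots> \<le> C * (1 + \<bar>x\<bar>)"
      using B by (simp add: C_def algebra_simps add_nonneg_nonneg)
    finally show ?thesis .
  qed
  with C0 show thesis by (rule that)
qed

text \<open>C does not depend on n: v/n is x d with |x| at most r, so one bound on the line through
  d serves all terms at once.\<close>

lemma Gs_term_ray_bound:
  assumes t': "Im t' > 0" and d: "d \<in> sector (l_dir t' k) (l_dir t' (k - 1))" and s: "\<bar>s\<bar> = (1::int)"
  obtains C where "C \<ge> 0"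
    "\<And>r n. r \<ge> 0 \<Longrightarrow> n \<noteq> 0 \<Longrightarrow>
      norm (Gs_term (of_real r * (of_int s * d)) t' n) \<le> C * (1 + r) / (of_int n)\<^sup>2"
proof -
  obtain C where C: "C \<ge> 0"
    "\<And>x::real. norm (phi (of_real x * d + 2 * of_real pi * \<i> * t')) \<le> C * (1 + \<bar>x\<bar>)"
    using phi_line_bound[OF t' d] by blast
  have "norm (Gs_term (of_real r * (of_int s * d)) t' n) \<le> C * (1 + r) / (of_int n)\<^sup>2"
    if r: "r \<ge> 0" and n: "n \<noteq> 0" for r :: real and n :: int
  proof -
    define x where "x = r * of_int s / of_int n"
    have s': "\<bar>of_int s\<bar> = (1::real)" using s by linarith
    have n': "\<bar>of_int n\<bar> \<ge> (1::real)" using n by linarith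
    have "\<bar>x\<bar> \<le> r" using r n' s' mult_left_mono[of 1 "\<bar>of_int n\<bar>" r]
      by (simp add: x_def abs_mult field_simps)
    then have "C * (1 + \<bar>x\<bar>) \<le> C * (1 + r)" using C by (intro mult_left_mono) auto
    moreover have "of_real r * (of_int s * d) / of_int n = of_real x * d" by (simp add: x_def)
    ultimately have "norm (phi (of_real r * (of_int s * d) / of_int n + 2 * of_real pi * \<i> * t')) \<le> C * (1 + r)"
      using C(2)[of x] by simp
    then show ?thesis
      using n by (simp add: Gs_term_eq_phi norm_divide norm_power divide_right_mono)
  qed
  with C(1) show thesis by (rule that)
qed

subsection \<open>Rotation of rays\<close>

lemma set_integrable_affine_exp:
  assumes c: "c > 0"
  shows "set_integrable lborel {0<..} (\<lambda>r::real. (1 + r) * exp (- c * r))"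
proof -
  have "set_integrable lebesgue {0..} (\<lambda>r. exp (- (c / 2) * r))"
    using c by (intro nonnegative_absolutely_integrable_1 integrable_on_exp_minus_to_infinity) auto
  then have "set_integrable lebesgue {0<..} (\<lambda>r. exp (- (c / 2) * r))"
    by (rule set_integrable_subset) auto
  then have "set_integrable lborel {0<..} (\<lambda>r. exp (- (c / 2) * r))"
    unfolding set_integrable_def
    by (subst (asm) integrable_completion) (auto intro!: borel_measurable_continuous_on_indicator continuous_intros)
  \<comment> \<open>Half of the exponent absorbs the linear factor: 1 + r is at most (1 + 2/c) (1 +
    c r / 2), hence at most (1 + 2/c) exp (c r / 2).\<close>
  then have "set_integrable lborel {0<..} (\<lambda>r. (1 + 2 / c) * exp (- (c / 2) * r))"
    by (rule set_integrable_mult_right)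
  then show ?thesis
  proof (rule set_integrable_bound)
    show "set_borel_measurable lborel {0<..} (\<lambda>r. (1 + r) * exp (- c * r))"
      unfolding set_borel_measurable_def
      by (auto intro!: borel_measurable_continuous_on_indicator continuous_intros)
    have "(1 + r) * exp (- c * r) \<le> (1 + 2 / c) * exp (- (c / 2) * r)" if r: "r > 0" for r
    proof -
      have E: "exp (c / 2 * r) \<ge> 1 + c / 2 * r" by simp
      have "1 + r \<le> (1 + 2 / c) * (1 + c / 2 * r)" using c r by (simp add: field_simps)
      also have "\<dots> \<le> (1 + 2 / c) * exp (c / 2 * r)" using E c by (intro mult_left_mono) auto
      finally have "(1 + r) * exp (- c * r) \<le> (1 + 2 / c) * exp (c / 2 * r) * exp (- c * r)"
        by (intro mult_right_mono) auto
      also have "\<dots> = (1 + 2 / c) * (exp (c / 2 * r) * exp (- c * r))" by simp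
      also have "exp (c / 2 * r) * exp (- c * r) = exp (- (c / 2) * r)"
        by (subst exp_add [symmetric]) (simp add: field_simps)
      finally show ?thesis .
    qed
    then show "AE r in lborel. r \<in> {0<..} \<longrightarrow>
        norm ((1 + r) * exp (- c * r)) \<le> norm ((1 + 2 / c) * exp (- (c / 2) * r))"
      using c by (intro AE_I2) (auto simp: abs_mult)
  qed
qed

lemma has_contour_integral_segment:
  assumes "ray_integrable d g" "R > 0"
  shows "(g has_contour_integral (LINT r:{0<..R}|lborel. g (of_real r * d) * d)) (linepath 0 (of_real R * d))"
proof -
  let ?f = "\<lambda>r. g (of_real r * d) * d"
  have int: "set_integrable lborel {0<..R} ?f"
    using assms(1) unfolding ray_integrable_def by (rule set_integrable_subset) auto
  have "(?f has_integral (LINT r:{0<..R}|lborel. ?f r)) {0<..R}"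
    using set_borel_integral_eq_integral[OF int] by (simp only: has_integral_integrable_integral)
  then have "(?f has_integral (LINT r:{0<..R}|lborel. ?f r)) {0..R}"
    by (rule has_integral_spike_set_eq[THEN iffD1, rotated -1])
      (auto intro: negligible_subset[of "{0}"])
  from has_integral_stretch_real[OF this, of R] assms(2)
  have "((\<lambda>x. ?f (R * x)) has_integral (1 / R) *\<^sub>R (LINT r:{0<..R}|lborel. ?f r)) {0..1}"
    by (simp add: image_divide_atLeastAtMost del: set_integral_mult_left)
  from has_integral_cmul[OF this, of R] assms(2)
  have "((\<lambda>x. R *\<^sub>R ?f (R * x)) has_integral (LINT r:{0<..R}|lborel. ?f r)) {0..1}"
    by (simp del: set_integral_mult_left)
  moreover have "R *\<^sub>R ?f (R * x) = g (linepath 0 (of_real R * d) x) * (of_real R * d - 0)" for x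
    by (simp add: linepath_def scaleR_conv_of_real mult_ac)
  ultimately show ?thesis unfolding has_contour_integral_linepath by (simp del: set_integral_mult_left)
qed

lemma ray_integral_limit:
  assumes "ray_integrable d g"
  shows "((\<lambda>R. LINT r:{0<..R}|lborel. g (of_real r * d) * d) \<longlongrightarrow> ray_integral d g) at_top"
proof -
  let ?f = "\<lambda>r. indicator {0<..} r *\<^sub>R (g (of_real r * d) * d)"
  have "set_integrable lborel {0..} ?f"
    using assms unfolding ray_integrable_def set_integrable_def
    by (rule Bochner_Integration.integrable_cong[THEN iffD1, rotated -1]) (auto split: split_indicator)
  then have "((\<lambda>R. LINT r:{0..R}|lborel. ?f r) \<longlongrightarrow> (LINT r:{0..}|lborel. ?f r)) at_top"
    by (intro tendsto_set_lebesgue_integral_at_top) auto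
  moreover have "(LINT r:{0..R}|lborel. ?f r) = (LINT r:{0<..R}|lborel. g (of_real r * d) * d)" for R
    unfolding set_lebesgue_integral_def
    by (intro Bochner_Integration.integral_cong) (auto split: split_indicator)
  moreover have "(LINT r:{0..}|lborel. ?f r) = ray_integral d g"
    unfolding set_lebesgue_integral_def ray_integral_def
    by (intro Bochner_Integration.integral_cong) (auto split: split_indicator)
  ultimately show ?thesis by (simp only:)
qed

text \<open>The last two factors model the integrand on the far side of the triangle of size R; the
  first is the length of that side up to a constant.\<close>

lemma quadratic_exp_tendsto_0:
  assumes "c > (0::real)"
  shows "((\<lambda>R. R * ((1 + R) * exp (- c * R))) \<longlongrightarrow> 0) at_top"
proof -
  have lim: "filterlim (\<lambda>R. c * R) at_top at_top"
    using assms by (intro filterlim_tendsto_pos_mult_at_top[OF tendsto_const]) (auto simp: filterlim_ident)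
  have "((\<lambda>R. 1 / c * ((c * R) ^ 1 / exp (c * R)) + 1 / c\<^sup>2 * ((c * R)\<^sup>2 / exp (c * R)))
      \<longlongrightarrow> 1 / c * 0 + 1 / c\<^sup>2 * 0) at_top"
    by (intro tendsto_intros filterlim_compose[OF tendsto_power_div_exp_0 lim])
  moreover have "1 / c * ((c * R) ^ 1 / exp (c * R)) + 1 / c\<^sup>2 * ((c * R)\<^sup>2 / exp (c * R))
      = R * ((1 + R) * exp (- c * R))" for R
    using assms by (simp add: exp_minus field_simps power2_eq_square)
  ultimately show ?thesis by simp
qed

text \<open>The integral over the closed triangle has the same value V for all large R, while the
  far side contributes a vanishing amount; the two remaining sides tend to the ray integrals. V is 0
  when no pole is enclosed and 2 pi i times the residue otherwise.\<close>

lemma triangle_rotation: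
  fixes d e :: complex
  assumes id: "ray_integrable d g" and ie: "ray_integrable e g" and c: "c > 0" "C \<ge> 0"
    and bound: "\<And>R u. R \<ge> R0 \<Longrightarrow> u \<in> closed_segment (of_real R * e) (of_real R * d) \<Longrightarrow>
        norm (g u) \<le> C * (1 + R) * exp (- c * R)"
    and tri: "\<And>R. R \<ge> R0 \<Longrightarrow> (g has_contour_integral V)
        (linepath 0 (of_real R * e) +++ linepath (of_real R * e) (of_real R * d) +++ linepath (of_real R * d) 0)"
  shows "ray_integral e g - ray_integral d g = V"
proof -
  define I where "I d R = (LINT r:{0<..R}|lborel. g (of_real r * d) * d)" for d R
  have bd: "norm (V - (I e R - I d R)) \<le> C * (1 + R) * exp (- c * R) * (R * norm (d - e))"
    if R: "R \<ge> max 1 R0" for R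
  proof -
    have R1: "R > 0" "R \<ge> R0" using R by auto
    have e: "(g has_contour_integral I e R) (linepath 0 (of_real R * e))"
      and d: "(g has_contour_integral I d R) (linepath 0 (of_real R * d))"
      unfolding I_def by (intro has_contour_integral_segment id ie R1)+
    have d': "(g has_contour_integral - I d R) (linepath (of_real R * d) 0)"
      using has_contour_integral_reversepath[OF _ d] by simp
    \<comment> \<open>Integrability on the far side is extracted from \<open>tri\<close>; its
      integral m is then what separates V from the difference of the two radial integrals.\<close>
    have "g contour_integrable_on (linepath (of_real R * e) (of_real R * d))"
      using contour_integrable_joinD1[OF contour_integrable_joinD2]
        has_contour_integral_integrable[OF tri[OF R1(2)]] by simp
    then obtain m where m: "(g has_contour_integral m) (linepath (of_real R * e) (of_real R * d))"
      by (auto simp: contour_integrable_on_def)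
    have "(g has_contour_integral (I e R + (m + - I d R)))
        (linepath 0 (of_real R * e) +++ linepath (of_real R * e) (of_real R * d) +++ linepath (of_real R * d) 0)"
      by (intro has_contour_integral_join e m d' valid_path_join) auto
    with tri[OF R1(2)] have "V = I e R + (m + - I d R)"
      by (rule has_contour_integral_unique)
    then have "V - (I e R - I d R) = m" by simp
    moreover have "norm m \<le> C * (1 + R) * exp (- c * R) * norm (of_real R * d - of_real R * e)"
      using R1 c by (intro has_contour_integral_bound_linepath[OF m] bound) auto
    moreover have "norm (of_real R * d - of_real R * e) = R * norm (d - e)"
      using R1 by (simp add: norm_mult flip: right_diff_distrib)
    ultimately show ?thesis by simp
  qed
  have "((\<lambda>R. C * (1 + R) * exp (- c * R) * (R * norm (d - e))) \<longlongrightarrow> 0) at_top"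
    using tendsto_mult_right_zero[OF quadratic_exp_tendsto_0[OF c(1)], of "C * norm (d - e)"]
    by (simp add: mult_ac)
  then have "((\<lambda>R. V - (I e R - I d R)) \<longlongrightarrow> 0) at_top"
    by (rule Lim_null_comparison[rotated]) (use bd in \<open>auto simp: eventually_at_top_linorder intro!: exI[of _ "max 1 R0"]\<close>)
  moreover have "((\<lambda>R. V - (I e R - I d R)) \<longlongrightarrow> V - (ray_integral e g - ray_integral d g)) at_top"
    unfolding I_def by (intro tendsto_intros ray_integral_limit id ie)
  ultimately have "V - (ray_integral e g - ray_integral d g) = 0"
    using tendsto_unique trivial_limit_at_top_linorder by blast
  then show ?thesis by simp
qed

text \<open>Re (d / lam') is the decay rate of the Laplace kernel along d, see
  \<open>norm_exp_ray\<close>. For lam' = 0 both sides are false.\<close>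

lemma half_plane_iff: "lam' \<in> half_plane d \<longleftrightarrow> Re (d / lam') > 0"
proof -
  have "Re (d / lam') = Re (lam' * cnj d) / (norm lam')\<^sup>2"
    by (simp add: Re_divide cmod_power2 algebra_simps)
  then show ?thesis
    by (cases "lam' = 0") (simp_all add: half_plane_def zero_less_divide_iff del: complex_cnj times_complex.sel)
qed

lemma norm_exp_ray: "norm (exp (- (of_real r * d) / lam')) = exp (- Re (d / lam') * r)"
proof -
  have "- (of_real r * d) / lam' = of_real (- r) * (d / lam')" by simp
  then have "Re (- (of_real r * d) / lam') = - Re (d / lam') * r"
    by (simp only: times_complex.sel Re_complex_of_real Im_complex_of_real) simp
  then show ?thesis by (simp only: norm_exp_eq_Re)
qed

section \<open>Analyticity and decay of the single terms\<close>

lemma phi_holomorphic: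
  assumes "\<And>u j. u \<in> S \<Longrightarrow> u \<noteq> l_dir t' j"
  shows "(\<lambda>u. phi (u + 2 * of_real pi * \<i> * t')) holomorphic_on S"
  unfolding phi_def
proof (intro holomorphic_intros)
  fix u assume "u \<in> S"
  then have "exp (- (u + 2 * of_real pi * \<i> * t')) \<noteq> 1"
    unfolding exp_l_dir_eq_1_iff using assms by blast
  then show "1 - exp (- (u + 2 * of_real pi * \<i> * t')) \<noteq> 0" by simp
qed

lemma Gs_term_holomorphic:
  assumes "n \<noteq> 0" "\<And>v j. v \<in> S \<Longrightarrow> v / of_int n \<noteq> l_dir t' j"
  shows "(\<lambda>v. Gs_term v t' n) holomorphic_on S"
proof -
  have "(\<lambda>v. v / of_int n) holomorphic_on S"
    using assms(1) by (intro holomorphic_intros) auto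
  moreover have "(\<lambda>u. phi (u + 2 * of_real pi * \<i> * t')) holomorphic_on (\<lambda>v. v / of_int n) ` S"
    using assms(2) by (intro phi_holomorphic) auto
  ultimately have "((\<lambda>u. phi (u + 2 * of_real pi * \<i> * t')) \<circ> (\<lambda>v. v / of_int n)) holomorphic_on S"
    by (rule holomorphic_on_compose)
  then show ?thesis
    using assms(1) by (auto simp: Gs_term_eq_phi o_def intro!: holomorphic_intros)
qed

lemma Gs_term_ray_continuous:
  assumes t': "Im t' > 0" and d: "d \<in> sector (l_dir t' k) (l_dir t' (k - 1))" and n: "n \<noteq> 0"
  shows "continuous_on UNIV (\<lambda>r::real. exp (- (of_real r * (of_int s * d)) / lam')
    * Gs_term (of_real r * (of_int s * d)) t' n * (of_int s * d))"
proof -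
  let ?R = "range (\<lambda>r::real. of_real r * (of_int s * d))"
  have "v / of_int n \<noteq> l_dir t' j" if v: "v \<in> ?R" for v j
  proof -
    obtain r :: real where "v = of_real r * (of_int s * d)" using v by blast
    then have "v / of_int n = of_real (r * of_int s / of_int n) * d" by simp
    then show ?thesis using line_avoids_l_dir[OF t' d] by metis
  qed
  then have "continuous_on ?R (\<lambda>v. Gs_term v t' n)"
    using Gs_term_holomorphic[OF n] holomorphic_on_imp_continuous_on by blast
  moreover have "continuous_on UNIV (\<lambda>r::real. of_real r * (of_int s * d))"
    by (intro continuous_intros)
  ultimately have "continuous_on UNIV (\<lambda>r::real. Gs_term (of_real r * (of_int s * d)) t' n)"
    by (rule continuous_on_compose2) blast
  then show ?thesis
    by (cases "lam' = 0") (auto intro!: continuous_intros)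
qed

text \<open>The majorant is a product of a summable factor in n and a function of r that is
  integrable once lam' lies in the half-plane. This is the form required for exchanging sum and
  integral in \<open>Gs_ray_sums\<close>.\<close>

lemma Gs_term_integrand_bound:
  assumes t': "Im t' > 0" and d: "d \<in> sector (l_dir t' k) (l_dir t' (k - 1))" and s: "\<bar>s\<bar> = (1::int)"
  obtains C where "C \<ge> 0"
    "\<And>r n. r \<ge> 0 \<Longrightarrow> n \<noteq> 0 \<Longrightarrow>
      norm (exp (- (of_real r * (of_int s * d)) / lam') * Gs_term (of_real r * (of_int s * d)) t' n * (of_int s * d))
        \<le> C / (of_int n)\<^sup>2 * ((1 + r) * exp (- Re (of_int s * d / lam') * r))"
proof -
  obtain C where C: "C \<ge> 0"
    "\<And>r n. r \<ge> 0 \<Longrightarrow> n \<noteq> 0 \<Longrightarrow>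
      norm (Gs_term (of_real r * (of_int s * d)) t' n) \<le> C * (1 + r) / (of_int n)\<^sup>2"
    using Gs_term_ray_bound[OF t' d s] by blast
  let ?C = "C * norm (of_int s * d)"
  have "norm (exp (- (of_real r * (of_int s * d)) / lam') * Gs_term (of_real r * (of_int s * d)) t' n * (of_int s * d))
        \<le> ?C / (of_int n)\<^sup>2 * ((1 + r) * exp (- Re (of_int s * d / lam') * r))"
    if "r \<ge> 0" "n \<noteq> 0" for r n
  proof -
    have "norm (exp (- (of_real r * (of_int s * d)) / lam') * Gs_term (of_real r * (of_int s * d)) t' n * (of_int s * d))
      = exp (- Re (of_int s * d / lam') * r) * norm (Gs_term (of_real r * (of_int s * d)) t' n) * norm (of_int s * d)"
      by (simp only: norm_mult norm_exp_ray)
    also have "\<dots> \<le> exp (- Re (of_int s * d / lam') * r) * (C * (1 + r) / (of_int n)\<^sup>2) * norm (of_int s * d)"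
      by (intro mult_right_mono mult_left_mono C that) auto
    also have "\<dots> = ?C / (of_int n)\<^sup>2 * ((1 + r) * exp (- Re (of_int s * d / lam') * r))"
      by simp
    finally show ?thesis .
  qed
  moreover have "?C \<ge> 0" using C(1) by simp
  ultimately show thesis by (rule that[rotated])
qed

lemma Gs_term_ray_integrable:
  assumes t': "Im t' > 0" and d: "d \<in> sector (l_dir t' k) (l_dir t' (k - 1))" and s: "\<bar>s\<bar> = (1::int)"
    and lam': "lam' \<in> half_plane (of_int s * d)" and n: "n \<noteq> 0"
  shows "ray_integrable (of_int s * d) (\<lambda>v. exp (- v / lam') * Gs_term v t' n)"
proof -
  let ?f = "\<lambda>r::real. exp (- (of_real r * (of_int s * d)) / lam')
    * Gs_term (of_real r * (of_int s * d)) t' n * (of_int s * d)"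
  obtain C where C: "C \<ge> 0"
    "\<And>r n. r \<ge> 0 \<Longrightarrow> n \<noteq> 0 \<Longrightarrow>
      norm (exp (- (of_real r * (of_int s * d)) / lam') * Gs_term (of_real r * (of_int s * d)) t' n * (of_int s * d))
        \<le> C / (of_int n)\<^sup>2 * ((1 + r) * exp (- Re (of_int s * d / lam') * r))"
    using Gs_term_integrand_bound[OF t' d s] by blast
  have "set_integrable lborel {0<..} (\<lambda>r. C / (of_int n)\<^sup>2 * ((1 + r) * exp (- Re (of_int s * d / lam') * r)))"
    using lam' by (intro set_integrable_mult_right set_integrable_affine_exp) (simp add: half_plane_iff)
  then have "set_integrable lborel {0<..} ?f"
  proof (rule set_integrable_bound)
    show "set_borel_measurable lborel {0<..} ?f"
      unfolding set_borel_measurable_def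
      using continuous_on_subset[OF Gs_term_ray_continuous[OF t' d n]]
      by (auto intro!: borel_measurable_continuous_on_indicator)
    show "AE r in lborel. r \<in> {0<..} \<longrightarrow> norm (?f r)
        \<le> norm (C / (of_int n)\<^sup>2 * ((1 + r) * exp (- Re (of_int s * d / lam') * r)))"
    proof (intro AE_I2 impI)
      fix r :: real assume "r \<in> {0<..}"
      then show "norm (?f r) \<le> norm (C / (of_int n)\<^sup>2 * ((1 + r) * exp (- Re (of_int s * d / lam') * r)))"
        using C(2)[OF _ n, of r] abs_ge_self order.trans unfolding real_norm_def by fastforce
    qed
  qed
  then show ?thesis unfolding ray_integrable_def .
qed

text \<open>A point of the segment is R s w with w a convex combination of d and e. Both Re w and
  the decay rate Re (s w / lam') are affine in w, so each is at least the minimum of its two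
  endpoint values; these minima are \<open>m\<close> and \<open>c\<close>.\<close>

lemma Gs_term_segment_bound:
  assumes t': "Im t' > 0"
    and d: "d \<in> sector (l_dir t' k) (l_dir t' (k - 1))"
    and e: "e \<in> sector (l_dir t' (k + 1)) (l_dir t' k)"
    and s: "\<bar>s\<bar> = (1::int)" and n: "n \<noteq> 0"
    and lam': "lam' \<in> half_plane (of_int s * d)" "lam' \<in> half_plane (of_int s * e)"
  obtains c C R0 where "c > 0" "C \<ge> 0" "R0 > 0"
    "\<And>R u. R \<ge> R0 \<Longrightarrow> u \<in> closed_segment (of_real R * (of_int s * e)) (of_real R * (of_int s * d)) \<Longrightarrow>
        norm (exp (- u / lam') * Gs_term u t' n) \<le> C * (1 + R) * exp (- c * R)"
proof -
  have Re: "Re d > 0" "Re e > 0"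
    using sector_sides[OF t' d] sector_sides[OF t', of e "k + 1"] e by simp_all
  define c where "c = min (Re (of_int s * d / lam')) (Re (of_int s * e / lam'))"
  define m where "m = min (Re d) (Re e)"
  define N where "N = \<bar>real_of_int n\<bar>"
  \<comment> \<open>From this radius on |Re (u/n)| is at least 1 + 2 pi Im t', so
    \<open>norm_phi_le\<close> applies. It grows with |n|, just as the poles n l'_j move
    outwards.\<close>
  define R0 where "R0 = N * (1 + 2 * pi * Im t') / m"
  define C where "C = 2 * (norm d + norm e) + 2 * norm (2 * of_real pi * \<i> * t')"
  have c: "c > 0" using lam' by (simp add: c_def half_plane_iff)
  have m: "m > 0" using Re by (simp add: m_def)
  have N: "N \<ge> 1" using n unfolding N_def by linarith
  have R0: "R0 > 0" using N m t' by (simp add: R0_def add_pos_pos)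
  have C: "C \<ge> 0" by (simp add: C_def)
  have s': "\<bar>of_int s\<bar> = (1::real)" using s by linarith
  have "norm (exp (- u / lam') * Gs_term u t' n) \<le> C * (1 + R) * exp (- c * R)"
    if R: "R \<ge> R0" and u: "u \<in> closed_segment (of_real R * (of_int s * e)) (of_real R * (of_int s * d))" for R u
  proof -
    have Rp: "R > 0" using R R0 by simp
    obtain x where x: "0 \<le> x" "x \<le> 1"
      and u: "u = (1 - x) *\<^sub>R (of_real R * (of_int s * e)) + x *\<^sub>R (of_real R * (of_int s * d))"
      using u by (auto simp: closed_segment_def)
    define w where "w = of_real (1 - x) * e + of_real x * d"
    have uw: "u = of_real R * (of_int s * w)"
      by (simp add: u w_def scaleR_conv_of_real algebra_simps)
    have conv: "min a b \<le> (1 - x) * a + x * b" for a b :: real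
    proof -
      have "min a b = (1 - x) * min a b + x * min a b" by (simp add: algebra_simps)
      also have "\<dots> \<le> (1 - x) * a + x * b" using x by (intro add_mono mult_left_mono) auto
      finally show ?thesis .
    qed
    have "of_int s * w / lam' = of_real (1 - x) * (of_int s * e / lam') + of_real x * (of_int s * d / lam')"
    proof -
      have "of_int s * w = of_real (1 - x) * (of_int s * e) + of_real x * (of_int s * d)"
        by (simp add: w_def algebra_simps)
      then show ?thesis by (simp add: add_divide_distrib)
    qed
    then have "Re (of_int s * w / lam') = (1 - x) * Re (of_int s * e / lam') + x * Re (of_int s * d / lam')"
      by (simp only: plus_complex.sel times_complex.sel Re_complex_of_real Im_complex_of_real)
    then have Rew: "c \<le> Re (of_int s * w / lam')"
      using conv[of "Re (of_int s * e / lam')" "Re (of_int s * d / lam')"] by (simp add: c_def min.commute)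
    have "norm (exp (- u / lam')) \<le> exp (- c * R)"
      unfolding uw norm_exp_ray using Rew Rp by simp
    moreover have "norm (Gs_term u t' n) \<le> C * (1 + R)"
    proof -
      let ?w = "u / of_int n + 2 * of_real pi * \<i> * t'"
      have un: "u / of_int n = of_real (R * of_int s / of_int n) * w" by (simp add: uw)
      have co: "\<bar>R * of_int s / of_int n\<bar> = R / N" using Rp s' by (simp add: N_def abs_mult)
      have "m \<le> Re w" using conv[of "Re e" "Re d"] by (simp add: w_def m_def min.commute)
      then have "R / N * m \<le> \<bar>R * of_int s / of_int n\<bar> * \<bar>Re w\<bar>"
        unfolding co using Rp N by (intro mult_left_mono) auto
      also have "\<dots> = \<bar>Re (u / of_int n)\<bar>" unfolding un by (simp add: abs_mult)
      also have "1 + 2 * pi * Im t' \<le> R / N * m"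
        using R m N by (simp add: R0_def field_simps)
      finally have "1 + 2 * pi * Im t' \<le> \<bar>Re (u / of_int n)\<bar>" by simp
      moreover have "Re ?w = Re (u / of_int n) - 2 * pi * Im t'" by simp
      moreover have "2 * pi * Im t' > 0" using t' by simp
      ultimately have "1 \<le> \<bar>Re ?w\<bar>" by linarith
      then have "norm (phi ?w) \<le> 2 * norm ?w" by (rule norm_phi_le)
      also have "\<dots> \<le> 2 * (R / N * norm w + norm (2 * of_real pi * \<i> * t'))"
        by (intro mult_left_mono order.trans[OF norm_triangle_ineq])
          (simp_all only: un norm_mult norm_of_real co order.refl)
      also have "R / N * norm w \<le> R * (norm d + norm e)"
      proof (intro mult_mono)
        show "R / N \<le> R" using N Rp by (simp add: divide_le_eq)
        have "norm w \<le> (1 - x) * norm e + x * norm d"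
          unfolding w_def using x by (intro order.trans[OF norm_triangle_ineq]) (simp add: norm_mult del: of_real_diff)
        also have "\<dots> \<le> 1 * norm e + 1 * norm d" using x by (intro add_mono mult_right_mono) auto
        finally show "norm w \<le> norm d + norm e" by simp
      qed (use Rp in auto)
      also have "2 * (R * (norm d + norm e) + norm (2 * of_real pi * \<i> * t')) \<le> C * (1 + R)"
        using Rp unfolding C_def by (simp add: algebra_simps)
      finally have "norm (phi ?w) \<le> C * (1 + R)" by simp
      moreover have "norm (Gs_term u t' n) = norm (phi ?w) / N\<^sup>2"
        using n by (simp add: Gs_term_eq_phi norm_divide norm_power N_def)
      moreover have "norm (phi ?w) / N\<^sup>2 \<le> norm (phi ?w)"
        using N mult_left_mono[of 1 "N\<^sup>2" "norm (phi ?w)"] by (simp add: divide_le_eq one_le_power)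
      ultimately show ?thesis by linarith
    qed
    ultimately have "norm (exp (- u / lam')) * norm (Gs_term u t' n) \<le> exp (- c * R) * (C * (1 + R))"
      by (intro mult_mono) auto
    then show ?thesis by (simp add: norm_mult mult_ac)
  qed
  with c C R0 show thesis by (rule that)
qed

lemma not_collinear_scaled:
  fixes d e :: complex
  assumes "Im (e * cnj d) \<noteq> 0" "r \<noteq> 0"
  shows "\<not> collinear {0, of_real r * e, of_real r * d}"
proof
  assume "collinear {0, of_real r * e, of_real r * d}"
  then have "of_real r * e = 0 \<or> of_real r * d = 0 \<or> (\<exists>c. of_real r * d = c *\<^sub>R (of_real r * e))"
    by (simp add: collinear_lemma)
  then have "e = 0 \<or> d = 0 \<or> (\<exists>c. d = of_real c * e)"
    using assms(2) by (auto simp: scaleR_conv_of_real)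
  then show False using assms(1) by (auto simp: algebra_simps)
qed

section \<open>Jumps of the single terms\<close>

text \<open>The possible poles n l'_j have real part of the sign of n, while the triangle lies in
  the half-plane where Re v has the sign of s or vanishes. Cauchy's theorem on that half-plane gives
  0.\<close>

lemma Gs_term_no_jump:
  assumes t': "Im t' > 0"
    and d: "d \<in> sector (l_dir t' k) (l_dir t' (k - 1))"
    and e: "e \<in> sector (l_dir t' (k + 1)) (l_dir t' k)"
    and s: "\<bar>s\<bar> = (1::int)" and n: "s * n < 0"
    and lam': "lam' \<in> half_plane (of_int s * d)" "lam' \<in> half_plane (of_int s * e)"
  shows "ray_integral (of_int s * e) (\<lambda>v. exp (- v / lam') * Gs_term v t' n)
    - ray_integral (of_int s * d) (\<lambda>v. exp (- v / lam') * Gs_term v t' n) = 0"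
proof -
  let ?g = "\<lambda>v. exp (- v / lam') * Gs_term v t' n"
  have n0: "n \<noteq> 0" using n by auto
  have Re: "Re d > 0" "Re e > 0"
    using sector_sides[OF t' d] sector_sides[OF t', of e "k + 1"] e by simp_all
  have lam0: "lam' \<noteq> 0" using lam' by (auto simp: half_plane_def)
  obtain c C R0 where B: "c > 0" "C \<ge> 0" "R0 > 0"
    "\<And>R u. R \<ge> R0 \<Longrightarrow> u \<in> closed_segment (of_real R * (of_int s * e)) (of_real R * (of_int s * d)) \<Longrightarrow>
        norm (exp (- u / lam') * Gs_term u t' n) \<le> C * (1 + R) * exp (- c * R)"
    using Gs_term_segment_bound[OF t' d e s n0 lam'] by blast
  show ?thesis
  proof (rule triangle_rotation[OF _ _ B(1,2,4)])
    fix R assume R: "R \<ge> R0"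
    let ?H = "{v. 0 \<le> of_int s * Re v}"
    have ns: "\<not> (0 < of_int n * of_int s * (1::real))"
      using n by (simp add: mult.commute flip: of_int_mult)
    have H: "convex ?H"
      using convex_halfspace_ge[of 0 "of_real (of_int s) :: complex"] by (simp add: inner_complex_def)
    have sq: "of_int s * of_int s = (1::real)"
      using s by (simp add: abs_if split: if_splits)
    have mem: "of_real R * (of_int s * d) \<in> ?H" "of_real R * (of_int s * e) \<in> ?H" "0 \<in> ?H"
    proof -
      have "of_int s * Re (of_real R * (of_int s * w)) = R * Re w" for w
      proof -
        have "of_int s * Re (of_real R * (of_int s * w)) = (of_int s * of_int s) * (R * Re w)"
          by simp
        then show ?thesis unfolding sq by simp
      qed
      then have scale: "of_real R * (of_int s * w) \<in> ?H \<longleftrightarrow> 0 \<le> R * Re w" for w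
        unfolding mem_Collect_eq by (simp only:)
      have "0 \<le> R * Re d" "0 \<le> R * Re e" using R B(3) Re by simp_all
      then show "of_real R * (of_int s * d) \<in> ?H" "of_real R * (of_int s * e) \<in> ?H" "0 \<in> ?H"
        unfolding scale by simp_all
    qed
    have "?g holomorphic_on ?H"
    proof (intro holomorphic_intros Gs_term_holomorphic n0)
      fix v j assume v: "v \<in> ?H"
      show "v / of_int n \<noteq> l_dir t' j"
      proof
        assume "v / of_int n = l_dir t' j"
        then have "v = of_int n * l_dir t' j" using n0 by (simp add: field_simps)
        then have "Re v = of_int n * (2 * pi * Im t')" by simp
        then have "0 \<le> of_int (s * n) * (2 * pi * Im t')" using v by (simp add: mult_ac)
        moreover have "real_of_int (s * n) * (2 * pi * Im t') < 0"
        proof (rule mult_neg_pos)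
          show "real_of_int (s * n) < 0" using n by linarith
        qed (use t' in simp)
        ultimately show False by linarith
      qed
    qed (use lam0 in auto)
    then show "(?g has_contour_integral 0) (linepath 0 (of_real R * (of_int s * e)) +++
        linepath (of_real R * (of_int s * e)) (of_real R * (of_int s * d)) +++ linepath (of_real R * (of_int s * d)) 0)"
      by (rule Cauchy_theorem_convex_simple[OF _ H])
        (simp_all add: valid_path_join path_image_join closed_segment_subset H mem del: mem_Collect_eq)
  qed (use Gs_term_ray_integrable[OF t' d s lam'(1) n0]
      Gs_term_ray_integrable[OF t', of e "k + 1" s lam' n] e s lam' n0 in simp_all)
qed

lemma Gs_term_jump:
  assumes t': "Im t' > 0"
    and d: "d \<in> sector (l_dir t' k) (l_dir t' (k - 1))"
    and e: "e \<in> sector (l_dir t' (k + 1)) (l_dir t' k)"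
    and s: "\<bar>s\<bar> = (1::int)" and n: "s * n > 0"
    and lam': "lam' \<in> half_plane (of_int s * d)" "lam' \<in> half_plane (of_int s * e)"
  shows "ray_integral (of_int s * e) (\<lambda>v. exp (- v / lam') * Gs_term v t' n)
    - ray_integral (of_int s * d) (\<lambda>v. exp (- v / lam') * Gs_term v t' n)
    = (2 * of_real pi)\<^sup>2 * (of_int k / of_int n * exp (- (of_int n * l_dir t' k) / lam'))"
proof -
  let ?g = "\<lambda>v. exp (- v / lam') * Gs_term v t' n"
  have n0: "n \<noteq> 0" using n by auto
  have lam0: "lam' \<noteq> 0" using lam' by (auto simp: half_plane_def)
  have sn: "real_of_int s * of_int n > 0" using n by (simp flip: of_int_mult)
  have ss: "real_of_int s * of_int s = 1"
    using s by (simp add: abs_if split: if_splits)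
  obtain c C R0 where B: "c > 0" "C \<ge> 0" "R0 > 0"
    "\<And>R u. R \<ge> R0 \<Longrightarrow> u \<in> closed_segment (of_real R * (of_int s * e)) (of_real R * (of_int s * d)) \<Longrightarrow>
        norm (exp (- u / lam') * Gs_term u t' n) \<le> C * (1 + R) * exp (- c * R)"
    using Gs_term_segment_bound[OF t' d e s n0 lam'] by blast
  obtain a b where ab: "a > 0" "b > 0" "l_dir t' k = of_real a * d + of_real b * e"
    using l_dir_between[OF t' d e] by blast
  \<comment> \<open>This is |n|. Writing n = N s cancels the sign of the rays against that of n,
    leaving positive coordinates for the pole.\<close>
  define N where "N = real_of_int s * of_int n"
  have N: "N > 0" using sn by (simp add: N_def)
  have nN: "complex_of_int n = of_real N * of_int s"
  proof -
    have "real_of_int n = N * of_int s" using ss by (simp add: N_def mult_ac)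
    then show ?thesis by (metis of_real_mult of_real_of_int_eq)
  qed
  \<comment> \<open>The pole has coordinates N a / R and N b / R along the two sides issuing from 0;
    their sum is below 1, so that it lies inside the triangle, exactly when R > N (a + b).\<close>
  define R1 where "R1 = max R0 (N * (a + b) + 1)"
  define z where "z = of_int n * l_dir t' k"
  \<comment> \<open>By \<open>phi_shift_eq\<close> this is the integrand with its factor 1 / (v - z)
    removed, in the shape of Cauchy's integral formula.\<close>
  define f where "f v = exp (- v / lam') * (v / of_int n + 2 * of_real pi * \<i> * t')
    * psi (v / of_int n - l_dir t' k) / of_int n" for v
  have fg: "f v / (v - z) = ?g v" if "v \<noteq> z" for v
  proof -
    have ne: "v / of_int n \<noteq> l_dir t' k" using that n0 by (auto simp: z_def field_simps)
    have "v - z = of_int n * (v / of_int n - l_dir t' k)" using n0 by (simp add: z_def field_simps)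
    then show ?thesis
      by (simp only: f_def Gs_term_eq_phi[OF n0] phi_shift_eq[OF ne]) (simp add: power2_eq_square mult_ac)
  qed
  have zn: "z / of_int n = l_dir t' k" using n0 by (simp add: z_def)
  \<comment> \<open>At the pole the middle factor is l'_k + 2 pi i t' = -2 pi i k and
    \<open>psi\<close> is 1.\<close>
  have fz: "2 * of_real pi * \<i> * f z
      = (2 * of_real pi)\<^sup>2 * (of_int k / of_int n * exp (- (of_int n * l_dir t' k) / lam'))"
    unfolding f_def zn by (simp add: psi_def z_def l_dir_def algebra_simps power2_eq_square)
  show ?thesis
  proof (rule triangle_rotation[OF _ _ B(1,2)])
    fix R assume R: "R \<ge> R1"
    then have R': "R \<ge> R0" "R > N * (a + b)" "R > 0" using B(3) by (auto simp: R1_def)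
    define A E where "A = of_real R * (of_int s * d)" "E = of_real R * (of_int s * e)"
    let ?S = "convex hull {0, E, A}"
    let ?p = "linepath 0 E +++ linepath E A +++ linepath A 0"
    have Imed: "Im (e * cnj d) < 0" by (rule Im_mult_cnj_sectors[OF t' d e])
    have "A = of_real (R * of_int s) * d" "E = of_real (R * of_int s) * e" by (simp_all add: A_E_def)
    moreover have "R * of_int s \<noteq> 0" using R' s by auto
    ultimately have ncol: "\<not> collinear {0, E, A}"
      using not_collinear_scaled[of e d "R * of_int s"] Imed by simp
    have zAE: "z = of_real (N * a / R) * A + of_real (N * b / R) * E"
      using R' by (simp add: z_def ab(3) nN A_E_def algebra_simps)
    have zint: "z \<in> interior ?S"
      unfolding interior_convex_hull_3_minimal[OF ncol DIM_complex]
    proof (intro CollectI exI conjI)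
      have "N * (a + b) / R < 1" using R' by simp
      then show "0 < 1 - N * b / R - N * a / R" by (simp add: add_divide_distrib distrib_left)
      show "0 < N * b / R" "0 < N * a / R" using R' N ab by simp_all
      show "(1 - N * b / R - N * a / R) *\<^sub>R 0 + (N * b / R) *\<^sub>R E + (N * a / R) *\<^sub>R A = z"
        unfolding zAE scaleR_conv_of_real by (simp add: add.commute)
    qed simp
    \<comment> \<open>Another singularity would be a point v with v/n = l'_j in the closed cone of d
      and e; uniqueness gives j = k, where \<open>psi\<close> is regular.\<close>
    have "psi holomorphic_on (\<lambda>v. v / of_int n - l_dir t' k) ` ?S"
    proof (rule psi_holomorphic)
      fix w assume "w \<in> (\<lambda>v. v / of_int n - l_dir t' k) ` ?S" and w1: "exp (- w) = 1"
      then obtain v where v: "v \<in> ?S" "w = v / of_int n - l_dir t' k" by blast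
      have "exp (- (v / of_int n + 2 * of_real pi * \<i> * t')) = 1"
        using w1 v(2) exp_shift_l_dir[of "v / of_int n" t' k] by simp
      then obtain j where j: "v / of_int n = l_dir t' j" unfolding exp_l_dir_eq_1_iff by blast
      from v(1) obtain x y where xy: "x \<ge> 0" "y \<ge> 0" "v = x *\<^sub>R A + y *\<^sub>R E"
        unfolding convex_hull_3 by (auto simp: add.commute)
      have "of_real (x * R / N) * d + of_real (y * R / N) * e = v / of_int n"
        using N s unfolding xy(3) A_E_def nN by (simp add: scaleR_conv_of_real field_simps)
      then have "of_real (x * R / N) * d + of_real (y * R / N) * e = l_dir t' j" using j by simp
      moreover have "x * R / N \<ge> 0" "y * R / N \<ge> 0" using xy R' N by simp_all
      ultimately have "j = k" using l_dir_in_cone_unique[OF t' d e] by blast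
      then show "w = 0" using v j by simp
    qed
    moreover have "(\<lambda>v. v / of_int n - l_dir t' k) holomorphic_on ?S"
      using n0 by (intro holomorphic_intros) auto
    ultimately have "(psi \<circ> (\<lambda>v. v / of_int n - l_dir t' k)) holomorphic_on ?S"
      by (rule holomorphic_on_compose[rotated])
    then have fhol: "f holomorphic_on ?S"
      unfolding f_def o_def using n0 lam0 by (intro holomorphic_intros) simp_all
    have pim: "path_image ?p = closed_segment 0 E \<union> closed_segment E A \<union> closed_segment A 0"
      by (auto simp: path_image_join)
    have zp: "path_image ?p \<subseteq> ?S - {z}"
    proof -
      have "z \<notin> path_image ?p"
        using zint unfolding pim interior_of_triangle[OF DIM_complex] by simp
      moreover have "path_image ?p \<subseteq> ?S"
        unfolding pim by (intro Un_least segments_subset_convex_hull)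
      ultimately show ?thesis by blast
    qed
    \<comment> \<open>Orientation is decided by the sign of Im (E cnj (E - z)). After expanding z in
      A and E the part with E cnj E is real, so only a negative multiple of e cnj d remains.\<close>
    have w: "winding_number ?p z = 1"
    proof -
      have "E * cnj (E - z) = of_real (1 - N * b / R) * (E * cnj E) - of_real (N * a / R) * (E * cnj A)"
        unfolding zAE by (simp add: algebra_simps)
      moreover have "E * cnj A = of_real (R\<^sup>2) * (e * cnj d)"
      proof -
        have "complex_of_int s * of_int s = 1" using ss by (metis of_real_mult of_real_of_int_eq of_real_1)
        moreover have "E * cnj A = of_int s * of_int s * (of_real (R\<^sup>2) * (e * cnj d))"
          by (simp add: A_E_def power2_eq_square mult_ac)
        ultimately show ?thesis by simp
      qed
      moreover have "E * cnj E = of_real ((norm E)\<^sup>2)" by (rule complex_norm_square [symmetric])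
      ultimately have "E * cnj (E - z) = of_real ((1 - N * b / R) * (norm E)\<^sup>2) - of_real (N * a / R * R\<^sup>2) * (e * cnj d)"
        by simp
      moreover have "Im (of_real x - of_real y * w) = - y * Im w" for x y w by simp
      ultimately have "Im (E * cnj (E - z)) = - (N * a / R * R\<^sup>2) * Im (e * cnj d)"
        by (simp only:)
      then have "Im ((E - 0) * cnj (E - z)) = - (N * a * R) * Im (e * cnj d)"
        using R' by (simp only: diff_zero) (simp add: power2_eq_square)
      also have "\<dots> > 0" using N ab R' Imed by (simp add: mult_pos_neg)
      finally show ?thesis using winding_number_triangle[OF zint] by simp
    qed
    have "((\<lambda>v. f v / (v - z)) has_contour_integral (2 * pi * \<i> * winding_number ?p z * f z)) ?p"
      by (rule Cauchy_integral_formula_convex_simple[OF convex_convex_hull fhol zint _ zp])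
        simp_all
    then have "(?g has_contour_integral (2 * pi * \<i> * winding_number ?p z * f z)) ?p"
      by (rule has_contour_integral_eq) (use zp fg in auto)
    then show "(?g has_contour_integral
        ((2 * of_real pi)\<^sup>2 * (of_int k / of_int n * exp (- (of_int n * l_dir t' k) / lam'))))
        (linepath 0 (of_real R * (of_int s * e)) +++
        linepath (of_real R * (of_int s * e)) (of_real R * (of_int s * d)) +++ linepath (of_real R * (of_int s * d)) 0)"
      unfolding w unfolding mult_1_right of_real_mult of_real_numeral unfolding fz unfolding A_E_def .
  next
    fix R u assume "R \<ge> R1" "u \<in> closed_segment (of_real R * (of_int s * e)) (of_real R * (of_int s * d))"
    then show "norm (?g u) \<le> C * (1 + R) * exp (- c * R)"
      by (intro B(4)) (auto simp: R1_def)
  qed (use Gs_term_ray_integrable[OF t' d s lam'(1) n0]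
      Gs_term_ray_integrable[OF t', of e "k + 1" s lam' n] e s lam' n0 in simp_all)
qed

subsection \<open>Summation over the poles\<close>

text \<open>Pairs n with -n, turning the unordered sum in \<open>Gs\<close> into a series over the
  naturals to which theorems on integrating series apply.\<close>

lemma has_sum_int_nonzero:
  fixes f :: "int \<Rightarrow> complex"
  assumes "summable (\<lambda>m. norm (f (int (Suc m))))" "summable (\<lambda>m. norm (f (- int (Suc m))))"
  shows "(f has_sum (\<Sum>m. f (int (Suc m)) + f (- int (Suc m)))) (UNIV - {0})"
proof -
  let ?h = "\<lambda>m. int (Suc m)" and ?k = "\<lambda>m. - int (Suc m)"
  have "((f \<circ> ?h) has_sum (\<Sum>m. f (?h m))) UNIV" "((f \<circ> ?k) has_sum (\<Sum>m. f (?k m))) UNIV"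
    unfolding o_def
    by (intro norm_summable_imp_has_sum summable_sums assms assms[THEN summable_norm_cancel])+
  moreover have "inj ?h" "inj ?k" by (auto simp: inj_on_def)
  ultimately have "(f has_sum (\<Sum>m. f (?h m))) (range ?h)" "(f has_sum (\<Sum>m. f (?k m))) (range ?k)"
    by (simp_all only: has_sum_reindex)
  then have "(f has_sum ((\<Sum>m. f (?h m)) + (\<Sum>m. f (?k m)))) (range ?h \<union> range ?k)"
    by (rule has_sum_Un_disjoint) auto
  moreover have "(\<Sum>m. f (?h m)) + (\<Sum>m. f (?k m)) = (\<Sum>m. f (?h m) + f (?k m))"
    by (intro suminf_add assms[THEN summable_norm_cancel])
  moreover have "range ?h \<union> range ?k = UNIV - {0}"
  proof (intro equalityI subsetI)
    fix x :: int assume x: "x \<in> UNIV - {0}"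
    show "x \<in> range ?h \<union> range ?k"
    proof (cases "x > 0")
      case True
      then have "x = ?h (nat (x - 1))" by simp
      then show ?thesis by blast
    next
      case False
      then have "x = ?k (nat (- x - 1))" using x by simp
      then show ?thesis by blast
    qed
  qed auto
  ultimately show ?thesis by simp
qed

text \<open>Pointwise summability rests on the bound \<open>K\<close>, termwise integration on the
  majorant with \<open>C\<close>; both are summable because of 1/n^2.\<close>

lemma Gs_ray_sums:
  assumes t': "Im t' > 0" and d: "d \<in> sector (l_dir t' k) (l_dir t' (k - 1))" and s: "\<bar>s\<bar> = (1::int)"
    and lam': "lam' \<in> half_plane (of_int s * d)"
  shows "\<forall>v\<in>ray (of_int s * d). Gs_term v t' summable_on UNIV - {0}" (is ?A)
    and "ray_integrable (of_int s * d) (\<lambda>v. exp (- v / lam') * Gs v t')" (is ?B)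
    and "(\<lambda>m. (ray_integral (of_int s * d) (\<lambda>v. exp (- v / lam') * Gs_term v t' (int (Suc m)))
           + ray_integral (of_int s * d) (\<lambda>v. exp (- v / lam') * Gs_term v t' (- int (Suc m)))) / (2 * of_real pi)\<^sup>2)
         sums ray_integral (of_int s * d) (\<lambda>v. exp (- v / lam') * Gs v t')" (is ?C)
proof -
  define e where "e = of_int s * d"
  define g where "g n r = exp (- (of_real r * e) / lam') * Gs_term (of_real r * e) t' n * e" for n and r :: real
  define h where "h r = (1 + r) * exp (- Re (e / lam') * r)" for r
  \<comment> \<open>The terms at m + 1 and -(m + 1) together, extended by 0 to the whole
    line.\<close>
  define f where "f m r = indicator {0<..} r *\<^sub>R g (int (Suc m)) r + indicator {0<..} r *\<^sub>R g (- int (Suc m)) r" for m r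
  let ?I = "\<lambda>n. ray_integral e (\<lambda>v. exp (- v / lam') * Gs_term v t' n)"
  obtain K where K: "K \<ge> 0"
    "\<And>r n. r \<ge> 0 \<Longrightarrow> n \<noteq> 0 \<Longrightarrow> norm (Gs_term (of_real r * e) t' n) \<le> K * (1 + r) / (of_int n)\<^sup>2"
    unfolding e_def using Gs_term_ray_bound[OF t' d s] by blast
  obtain C where C: "C \<ge> 0"
    "\<And>r n. r \<ge> 0 \<Longrightarrow> n \<noteq> 0 \<Longrightarrow> norm (g n r) \<le> C / (of_int n)\<^sup>2 * h r"
    unfolding e_def g_def h_def using Gs_term_integrand_bound[OF t' d s] by blast
  have sq: "summable (\<lambda>m. c / (real (Suc m))\<^sup>2)" for c :: real
  proof -
    have "summable (\<lambda>m. inverse (real (Suc m) ^ 2))"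
      using inverse_power_summable[of 2, where ?'a = real] by (subst summable_Suc_iff) simp
    from summable_mult[OF this, of c] show ?thesis by (simp only: divide_inverse)
  qed
  have neg_sq: "(real_of_int (- int (Suc m)))\<^sup>2 = (real (Suc m))\<^sup>2" for m
    by (simp only: of_int_minus power2_minus of_int_of_nat_eq)
  have Gs_sum: "(Gs_term (of_real r * e) t' has_sum
      (\<Sum>m. Gs_term (of_real r * e) t' (int (Suc m)) + Gs_term (of_real r * e) t' (- int (Suc m)))) (UNIV - {0})"
    and Gs_summable: "summable (\<lambda>m. Gs_term (of_real r * e) t' (int (Suc m)) + Gs_term (of_real r * e) t' (- int (Suc m)))"
    if r: "r > 0" for r
  proof -
    have 1: "summable (\<lambda>m. norm (Gs_term (of_real r * e) t' (int (Suc m))))"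
      by (rule summable_comparison_test'[OF sq[of "K * (1 + r)"], of 0])
        (use K(2)[of r "int (Suc _)"] r in simp)
    have 2: "summable (\<lambda>m. norm (Gs_term (of_real r * e) t' (- int (Suc m))))"
      by (rule summable_comparison_test'[OF sq[of "K * (1 + r)"], of 0])
        (use K(2)[of r "- int (Suc _)", unfolded neg_sq] r in simp)
    show "(Gs_term (of_real r * e) t' has_sum
      (\<Sum>m. Gs_term (of_real r * e) t' (int (Suc m)) + Gs_term (of_real r * e) t' (- int (Suc m)))) (UNIV - {0})"
      by (rule has_sum_int_nonzero[OF 1 2])
    show "summable (\<lambda>m. Gs_term (of_real r * e) t' (int (Suc m)) + Gs_term (of_real r * e) t' (- int (Suc m)))"
      by (intro summable_add 1[THEN summable_norm_cancel] 2[THEN summable_norm_cancel])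
  qed
  show ?A
    using Gs_sum unfolding e_def[symmetric] ray_def by (auto simp: summable_on_def)
  have gint: "integrable lborel (\<lambda>r. indicator {0<..} r *\<^sub>R g n r)" if "n \<noteq> 0" for n
    using Gs_term_ray_integrable[OF t' d s lam' that]
    unfolding e_def[symmetric] ray_integrable_def set_integrable_def g_def .
  have gI: "integral\<^sup>L lborel (\<lambda>r. indicator {0<..} r *\<^sub>R g n r) = ?I n" for n
    unfolding ray_integral_def set_lebesgue_integral_def g_def ..
  have hint: "integrable lborel (\<lambda>r. indicator {0<..} r *\<^sub>R h r)"
    using set_integrable_affine_exp[of "Re (e / lam')"] lam'
    unfolding set_integrable_def h_def e_def half_plane_iff by simp
  have fint: "integrable lborel (f m)" for m
    unfolding f_def by (intro Bochner_Integration.integrable_add gint) auto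
  have fbound: "norm (f m r) \<le> 2 * C / (real (Suc m))\<^sup>2 * (indicator {0<..} r *\<^sub>R h r)" for m r
  proof (cases "r > 0")
    case True
    have "norm (g (int (Suc m)) r) \<le> C / (real (Suc m))\<^sup>2 * h r"
      using C(2)[of r "int (Suc m)"] True by simp
    moreover have "norm (g (- int (Suc m)) r) \<le> C / (real (Suc m))\<^sup>2 * h r"
      using C(2)[of r "- int (Suc m)", unfolded neg_sq] True by simp
    ultimately have "norm (g (int (Suc m)) r + g (- int (Suc m)) r) \<le> 2 * (C / (real (Suc m))\<^sup>2 * h r)"
      using norm_triangle_ineq[of "g (int (Suc m)) r" "g (- int (Suc m)) r"] by linarith
    then show ?thesis using True by (simp add: f_def)
  qed (simp add: f_def)
  have AE: "AE r in lborel. summable (\<lambda>m. norm (f m r))"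
    by (intro AE_I2 summable_comparison_test'[OF summable_mult2[OF sq], of 0]) (use fbound in simp)
  have "norm (\<integral>r. norm (f m r) \<partial>lborel)
      \<le> 2 * C * (\<integral>r. indicator {0<..} r *\<^sub>R h r \<partial>lborel) / (real (Suc m))\<^sup>2" for m
  proof -
    have "norm (\<integral>r. norm (f m r) \<partial>lborel) = (\<integral>r. norm (f m r) \<partial>lborel)"
      by (simp add: integral_nonneg_AE)
    also have "\<dots> \<le> (\<integral>r. 2 * C / (real (Suc m))\<^sup>2 * (indicator {0<..} r *\<^sub>R h r) \<partial>lborel)"
      by (intro integral_mono integrable_norm fint integrable_mult_right hint fbound)
    also have "\<dots> = 2 * C / (real (Suc m))\<^sup>2 * (\<integral>r. indicator {0<..} r *\<^sub>R h r \<partial>lborel)"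
      by (rule integral_mult_right_zero)
    finally show ?thesis by simp
  qed
  then have sumint: "summable (\<lambda>m. \<integral>r. norm (f m r) \<partial>lborel)"
    by (intro summable_comparison_test'[OF sq, of 0]) auto
  have fsum: "(\<Sum>m. f m r) / (2 * of_real pi)\<^sup>2
      = indicator {0<..} r *\<^sub>R (exp (- (of_real r * e) / lam') * Gs (of_real r * e) t' * e)" for r
  proof (cases "r > 0")
    case True
    have "f m r = exp (- (of_real r * e) / lam') * e *
        (Gs_term (of_real r * e) t' (int (Suc m)) + Gs_term (of_real r * e) t' (- int (Suc m)))" for m
      using True by (simp add: f_def g_def algebra_simps)
    then have "(\<Sum>m. f m r) = exp (- (of_real r * e) / lam') * e *
        (\<Sum>m. Gs_term (of_real r * e) t' (int (Suc m)) + Gs_term (of_real r * e) t' (- int (Suc m)))"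
      by (simp only: suminf_mult[OF Gs_summable[OF True]])
    also have "\<dots> = exp (- (of_real r * e) / lam') * e * (\<Sum>\<^sub>\<infinity>n\<in>UNIV - {0}. Gs_term (of_real r * e) t' n)"
      by (simp only: infsumI[OF Gs_sum[OF True]])
    finally show ?thesis using True by (simp add: Gs_def)
  qed (simp add: f_def)
  have "integrable lborel (\<lambda>r. (\<Sum>m. f m r) / (2 * of_real pi)\<^sup>2)"
    by (intro integrable_divide_zero integrable_suminf fint AE sumint)
  then show ?B
    unfolding fsum ray_integrable_def set_integrable_def e_def .
  have "(\<lambda>m. integral\<^sup>L lborel (f m) / (2 * of_real pi)\<^sup>2)
      sums ((\<integral>r. (\<Sum>m. f m r) \<partial>lborel) / (2 * of_real pi)\<^sup>2)"
    by (intro sums_divide sums_integral fint AE sumint)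
  moreover have "integral\<^sup>L lborel (f m) = ?I (int (Suc m)) + ?I (- int (Suc m))" for m
    unfolding f_def gI[symmetric] by (intro Bochner_Integration.integral_add gint) auto
  moreover have "(\<integral>r. (\<Sum>m. f m r) \<partial>lborel) / (2 * of_real pi)\<^sup>2
      = ray_integral e (\<lambda>v. exp (- v / lam') * Gs v t')"
    unfolding ray_integral_def set_lebesgue_integral_def fsum[symmetric]
    by (rule integral_divide_zero[symmetric])
  ultimately show ?C unfolding e_def by simp
qed

lemma Ln_one_minus_sums:
  assumes "norm z < 1"
  shows "(\<lambda>m. z ^ Suc m / of_nat (Suc m)) sums (- Ln (1 - z))"
proof -
  have "(\<lambda>n. - (z ^ n / of_nat n)) sums Ln (1 - z)"
    using Ln_series'[of "- z"] assms by simp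
  then have "(\<lambda>n. z ^ n / of_nat n) sums (- Ln (1 - z))"
    using sums_minus by fastforce
  \<comment> \<open>The term at n = 0 is 1 / 0 = 0, so the shift of the index loses nothing.\<close>
  then show ?thesis by (subst sums_Suc_iff) simp
qed

text \<open>l'_k is a positive combination of d and e, so its decay rate is positive when theirs
  are. This is the convergence of the logarithmic series on the overlap of the two
  half-planes.\<close>

lemma norm_exp_l_dir_less_1:
  assumes t': "Im t' > 0"
    and d: "d \<in> sector (l_dir t' k) (l_dir t' (k - 1))"
    and e: "e \<in> sector (l_dir t' (k + 1)) (l_dir t' k)"
    and lam': "lam' \<in> half_plane (of_int s * d)" "lam' \<in> half_plane (of_int s * e)"
  shows "norm (exp (- (of_int s * l_dir t' k) / lam')) < 1"
proof -
  obtain a b where ab: "a > 0" "b > 0" "l_dir t' k = of_real a * d + of_real b * e"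
    using l_dir_between[OF t' d e] by blast
  have "- (of_int s * l_dir t' k) / lam' = of_real (- a) * (of_int s * d / lam') + of_real (- b) * (of_int s * e / lam')"
    by (simp add: ab(3) add_divide_distrib diff_divide_distrib ring_distribs mult_ac)
  then have "Re (- (of_int s * l_dir t' k) / lam') = - a * Re (of_int s * d / lam') + - b * Re (of_int s * e / lam')"
    by (simp only: plus_complex.sel times_complex.sel Re_complex_of_real Im_complex_of_real)
  moreover have "a * Re (of_int s * d / lam') > 0" "b * Re (of_int s * e / lam') > 0"
    using ab lam' by (simp_all add: half_plane_iff)
  ultimately have "Re (- (of_int s * l_dir t' k) / lam') < 0" by linarith
  then show ?thesis by (simp only: norm_exp_eq_Re exp_less_one_iff)
qed

text \<open>The polylogarithmic part of \<open>F'\<close> is independent of the ray and cancels, so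
  only the Laplace integrals are compared.\<close>

lemma F'_jump:
  assumes t': "Im t' > 0"
    and d: "d \<in> sector (l_dir t' k) (l_dir t' (k - 1))"
    and e: "e \<in> sector (l_dir t' (k + 1)) (l_dir t' k)"
    and s: "\<bar>s\<bar> = (1::int)"
    and lam': "lam' \<in> half_plane (of_int s * d)" "lam' \<in> half_plane (of_int s * e)"
  shows "F' (of_int s * e) lam' t' - F' (of_int s * d) lam' t'
    = - of_int s * of_int k * Ln (1 - exp (- (of_int s * l_dir t' k) / lam'))"
proof -
  let ?X = "exp (- (of_int s * l_dir t' k) / lam')"
  let ?I = "\<lambda>d n. ray_integral (of_int s * d) (\<lambda>v. exp (- v / lam') * Gs_term v t' n)"
  let ?J = "\<lambda>d. ray_integral (of_int s * d) (\<lambda>v. exp (- v / lam') * Gs v t')"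
  have e': "e \<in> sector (l_dir t' (k + 1)) (l_dir t' (k + 1 - 1))" using e by simp
  have s1: "s = 1 \<or> s = - 1" using s by linarith
  have terms: "(?I e (int (Suc m)) + ?I e (- int (Suc m))) / (2 * of_real pi)\<^sup>2
      - (?I d (int (Suc m)) + ?I d (- int (Suc m))) / (2 * of_real pi)\<^sup>2
      = of_int s * of_int k * (?X ^ Suc m / of_nat (Suc m))" for m
  proof -
    \<comment> \<open>Of the two indices m + 1 and -(m + 1) only this one has a jump. Since 1/s = s,
      dividing by it produces the sign s of the result.\<close>
    let ?n = "s * int (Suc m)"
    have pos: "s * ?n > 0" and neg: "s * (- ?n) < 0" using s1 by auto
    have E: "exp (- (of_int ?n * l_dir t' k) / lam') = ?X ^ Suc m"
      by (simp only: exp_of_nat_mult[symmetric]) (simp add: mult_ac)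
    have "(?I e ?n + ?I e (- ?n)) - (?I d ?n + ?I d (- ?n)) = (?I e ?n - ?I d ?n) + (?I e (- ?n) - ?I d (- ?n))"
      by simp
    also have "\<dots> = (2 * of_real pi)\<^sup>2 * (of_int k / of_int ?n * ?X ^ Suc m)"
      unfolding Gs_term_jump[OF t' d e s pos lam'] Gs_term_no_jump[OF t' d e s neg lam'] E by simp
    finally have "((?I e ?n + ?I e (- ?n)) - (?I d ?n + ?I d (- ?n))) / (2 * of_real pi)\<^sup>2 = of_int k / of_int ?n * ?X ^ Suc m"
      by simp
    moreover have "?I d ?n + ?I d (- ?n) = ?I d (int (Suc m)) + ?I d (- int (Suc m))" for d
      using s1 by (auto simp: add.commute)
    moreover have "of_int k / of_int ?n * ?X ^ Suc m = of_int s * of_int k * (?X ^ Suc m / of_nat (Suc m))"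
      using s1 by (auto simp del: power_Suc of_nat_Suc)
    ultimately show ?thesis by (simp only: diff_divide_distrib)
  qed
  have "(\<lambda>m. of_int s * of_int k * (?X ^ Suc m / of_nat (Suc m))) sums (?J e - ?J d)"
    using sums_diff[OF Gs_ray_sums(3)[OF t' e' s lam'(2)] Gs_ray_sums(3)[OF t' d s lam'(1)]]
    unfolding terms .
  moreover have "(\<lambda>m. of_int s * of_int k * (?X ^ Suc m / of_nat (Suc m))) sums (of_int s * of_int k * - Ln (1 - ?X))"
    by (intro sums_mult Ln_one_minus_sums norm_exp_l_dir_less_1[OF t' d e lam'])
  ultimately have "?J e - ?J d = of_int s * of_int k * - Ln (1 - ?X)"
    by (rule sums_unique2)
  then show ?thesis by (simp add: F'_def Let_def)
qed

section \<open>A Lambert double series\<close>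

text \<open>Summing the double series \<open>a\<close> over j first gives logarithms; summing over m
  first gives derivatives of geometric series. Absolute convergence allows the exchange.\<close>

lemma Ln_lambert_sums:
  fixes Q x :: complex
  assumes x: "norm x < 1" and Qx: "norm (Q * x) < 1"
  obtains S where
    "(\<lambda>m. of_nat (Suc m) * Ln (1 - Q * x ^ Suc m)) sums S"
    "(\<lambda>j. - (1 / of_nat (Suc j) * (Q ^ Suc j * (x ^ Suc j / (1 - x ^ Suc j)\<^sup>2)))) sums S"
proof -
  define a where "a = (\<lambda>(m, j). of_nat (Suc m) * ((Q * x ^ Suc m) ^ Suc j / of_nat (Suc j)))"
  \<comment> \<open>Smallness is assumed for \<open>Q * x\<close>, not for \<open>Q\<close>, so one
    factor x stays with Q in \<open>v\<close>. The remaining power of x has exponent m (j + 1),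
    which is at least m and so is dominated by the power in \<open>u\<close>.\<close>
  define u v where "u m = real (Suc m) * norm x ^ m" "v j = norm (Q * x) ^ Suc j" for m j
  have u: "summable u"
    using geometric_deriv_sums[of "norm x"] x unfolding u_v_def by (simp add: sums_iff)
  have v: "summable v"
    unfolding u_v_def power_Suc using Qx by (intro summable_mult summable_geometric) simp
  have u0: "u m \<ge> 0" and v0: "v j \<ge> 0" for m j by (simp_all add: u_v_def)
  have vhs: "(v has_sum suminf v) UNIV"
    using v v0 by (intro norm_summable_imp_has_sum summable_sums) simp_all
  have uv: "(\<lambda>(m, j). u m * v j) summable_on UNIV \<times> UNIV"
  proof (rule summable_on_SigmaI)
    show "((\<lambda>j. case (m, j) of (m, j) \<Rightarrow> u m * v j) has_sum u m * suminf v) UNIV" for m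
      using has_sum_cmult_right[OF vhs] by simp
    show "(\<lambda>m. u m * suminf v) summable_on UNIV"
      using u u0 by (intro summable_on_cmult_left norm_summable_imp_summable_on) simp
  qed (use u0 v0 in auto)
  have bound: "norm (a (m, j)) \<le> u m * v j" for m j
  proof -
    have "norm (Q * x ^ Suc m) ^ Suc j = norm (Q * x) ^ Suc j * (norm x ^ m) ^ Suc j"
      by (simp only: power_mult_distrib[symmetric]) (simp add: norm_mult norm_power mult_ac)
    also have "\<dots> \<le> norm (Q * x) ^ Suc j * (norm x ^ m) ^ 1"
      using x by (intro mult_left_mono power_decreasing power_le_one) auto
    finally have "real (Suc m) * (norm (Q * x ^ Suc m) ^ Suc j / real (Suc j))
        \<le> real (Suc m) * (norm (Q * x) ^ Suc j * (norm x ^ m) ^ 1 / 1)"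
      by (intro mult_left_mono frac_le) auto
    moreover have "norm (a (m, j)) = real (Suc m) * (norm (Q * x ^ Suc m) ^ Suc j / real (Suc j))"
      by (simp only: a_def prod.case norm_mult norm_divide norm_power norm_of_nat)
    ultimately show ?thesis by (simp add: u_v_def mult_ac del: power_Suc)
  qed
  have "a summable_on UNIV \<times> UNIV"
  proof (rule abs_summable_summable)
    show "(\<lambda>p. norm (a p)) summable_on UNIV \<times> UNIV"
      by (rule summable_on_comparison_test[OF uv]) (use bound in auto)
  qed
  then obtain A where A: "(a has_sum A) (UNIV \<times> UNIV)"
    by (auto simp: summable_on_def)
  have Qxm: "norm (Q * x ^ Suc m) < 1" for m
  proof -
    have "norm (Q * x ^ Suc m) = norm (Q * x) * norm x ^ m" by (simp add: norm_mult norm_power)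
    also have "\<dots> \<le> norm (Q * x) * 1"
      using x by (intro mult_left_mono power_le_one) auto
    finally show ?thesis using Qx by simp
  qed
  have "((\<lambda>j. a (m, j)) has_sum of_nat (Suc m) * - Ln (1 - Q * x ^ Suc m)) UNIV" for m
  proof (rule norm_summable_imp_has_sum)
    show "summable (\<lambda>j. norm (a (m, j)))"
      by (rule summable_comparison_test'[OF summable_mult[OF v, of "u m"], of 0]) (use bound in simp)
    show "(\<lambda>j. a (m, j)) sums (of_nat (Suc m) * - Ln (1 - Q * x ^ Suc m))"
      unfolding a_def prod.case by (intro sums_mult Ln_one_minus_sums Qxm)
  qed
  from has_sum_SigmaD[OF A this]
  have 1: "(\<lambda>m. of_nat (Suc m) * - Ln (1 - Q * x ^ Suc m)) sums A"
    by (intro has_sum_imp_sums) simp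
  have inner: "((\<lambda>m. a (m, j)) has_sum 1 / of_nat (Suc j) * (Q ^ Suc j * (x ^ Suc j / (1 - x ^ Suc j)\<^sup>2))) UNIV" for j
  proof (rule norm_summable_imp_has_sum)
    show "summable (\<lambda>m. norm (a (m, j)))"
      by (rule summable_comparison_test'[OF summable_mult2[OF u, of "v j"], of 0]) (use bound in simp)
    have "norm (x ^ Suc j) < 1"
      unfolding norm_power using x power_Suc_less_one[of "norm x" j] by (cases "x = 0") simp_all
    then have "(\<lambda>m. 1 / of_nat (Suc j) * Q ^ Suc j * x ^ Suc j * (of_nat (Suc m) * (x ^ Suc j) ^ m))
        sums (1 / of_nat (Suc j) * Q ^ Suc j * x ^ Suc j * (1 / (1 - x ^ Suc j)\<^sup>2))"
      by (intro sums_mult geometric_deriv_sums)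
    moreover have "1 / of_nat (Suc j) * Q ^ Suc j * x ^ Suc j * (of_nat (Suc m) * (x ^ Suc j) ^ m) = a (m, j)" for m
    proof -
      have "(Q * x ^ Suc m) ^ Suc j = Q ^ Suc j * (x ^ Suc j * (x ^ Suc j) ^ m)"
        by (simp only: power_mult_distrib power_Suc[of _ m] power_mult[symmetric] mult.commute[of m])
      then show ?thesis by (simp only: a_def prod.case) (simp del: power_Suc)
    qed
    ultimately show "(\<lambda>m. a (m, j)) sums (1 / of_nat (Suc j) * (Q ^ Suc j * (x ^ Suc j / (1 - x ^ Suc j)\<^sup>2)))"
      by (simp only:) (simp only: mult.assoc times_divide_eq_right mult_1_right)
  qed
  have swapped: "((\<lambda>(j, m). a (m, j)) has_sum A) (UNIV \<times> UNIV)"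
    using A has_sum_swap by blast
  have 2: "(\<lambda>j. 1 / of_nat (Suc j) * (Q ^ Suc j * (x ^ Suc j / (1 - x ^ Suc j)\<^sup>2))) sums A"
    by (rule has_sum_imp_sums[OF has_sum_SigmaD[OF swapped]]) (simp only: prod.case inner)
  show thesis
    using sums_minus[OF 1] sums_minus[OF 2] by (intro that[of "- A"]) simp_all
qed

subsection \<open>Limits of the jumps\<close>

text \<open>y / (1 - y)^2 is unchanged when y is replaced by 1/y. That is why the limits in both
  directions have the same sine form although one involves q and the other its inverse.\<close>

lemma lambert_term_eq_sin:
  assumes "x = exp (\<i> * lam) \<or> x = exp (- (\<i> * lam))"
  shows "x ^ n / (1 - x ^ n)\<^sup>2 = - (1 / (2 * sin (of_nat n * lam / 2))\<^sup>2)"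
proof -
  define E where "E = exp (\<i> * (of_nat n * lam / 2))"
  have E0: "E \<noteq> 0" and E': "exp (- (\<i> * (of_nat n * lam / 2))) = 1 / E"
    by (simp_all add: E_def exp_minus field_simps)
  have "2 * sin (of_nat n * lam / 2) = \<i> * (1 / E - E)"
    unfolding sin_exp_eq' E' E_def[symmetric] by simp
  then have sin2: "(2 * sin (of_nat n * lam / 2))\<^sup>2 = - (E - 1 / E)\<^sup>2"
    by (simp only: power_mult_distrib power2_commute[of "1 / E"]) simp
  have E2: "exp (\<i> * lam) ^ n = E\<^sup>2"
    unfolding E_def exp_of_nat_mult[symmetric] by (simp add: field_simps)
  have "exp (- (\<i> * lam)) ^ n = 1 / E\<^sup>2"
    unfolding E2[symmetric] by (simp add: exp_minus field_simps power_inverse)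
  then have "x ^ n = E\<^sup>2 \<or> x ^ n = 1 / E\<^sup>2" using assms E2 by auto
  moreover have "E\<^sup>2 / (1 - E\<^sup>2)\<^sup>2 = 1 / (E - 1 / E)\<^sup>2"
  proof -
    have "E - 1 / E = - (1 - E\<^sup>2) / E" using E0 by (simp add: field_simps power2_eq_square)
    then show ?thesis by (simp add: power_divide power2_commute[of 1])
  qed
  moreover have "(1 / E\<^sup>2) / (1 - 1 / E\<^sup>2)\<^sup>2 = 1 / (E - 1 / E)\<^sup>2"
  proof -
    have "1 - 1 / E\<^sup>2 = (E - 1 / E) / E" using E0 by (simp add: field_simps power2_eq_square)
    then show ?thesis using E0 by (simp add: power_divide)
  qed
  ultimately show ?thesis unfolding sin2 by auto
qed

text \<open>The minus sign of the Lambert series cancels the one from the squared sine.\<close>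

lemma stokes_sum_eq_sin_sum:
  fixes t lam x :: complex
  assumes "x = exp (\<i> * lam) \<or> x = exp (- (\<i> * lam))" "norm x < 1"
    and "norm (exp (2 * of_real pi * \<i> * t) * x) < 1"
  obtains S where
    "(\<lambda>m. of_nat (Suc m) * Ln (1 - exp (2 * of_real pi * \<i> * t) * x ^ Suc m)) sums S"
    "(\<lambda>k. 1 / of_nat (Suc k) *
        (exp (2 * of_real pi * \<i> * of_nat (Suc k) * t) / (2 * sin (of_nat (Suc k) * lam / 2)) ^ 2)) sums S"
proof -
  let ?Q = "exp (2 * of_real pi * \<i> * t)"
  have eq: "- (1 / of_nat (Suc j) * (?Q ^ Suc j * (x ^ Suc j / (1 - x ^ Suc j)\<^sup>2)))
    = 1 / of_nat (Suc j) *
        (exp (2 * of_real pi * \<i> * of_nat (Suc j) * t) / (2 * sin (of_nat (Suc j) * lam / 2)) ^ 2)" for j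
  proof -
    have "?Q ^ Suc j = exp (2 * of_real pi * \<i> * of_nat (Suc j) * t)"
      unfolding exp_of_nat_mult[symmetric] by (simp add: mult_ac)
    then show ?thesis unfolding lambert_term_eq_sin[OF assms(1)] by simp
  qed
  obtain S where
    "(\<lambda>m. of_nat (Suc m) * Ln (1 - ?Q * x ^ Suc m)) sums S"
    "(\<lambda>j. - (1 / of_nat (Suc j) * (?Q ^ Suc j * (x ^ Suc j / (1 - x ^ Suc j)\<^sup>2)))) sums S"
    using Ln_lambert_sums[OF assms(2,3)] by blast
  then show thesis unfolding eq by (rule that)
qed

lemma tendsto_int_at_top:
  fixes f :: "int \<Rightarrow> complex"
  assumes "(\<lambda>n. f (int n)) \<longlonglongrightarrow> L"
  shows "(f \<longlongrightarrow> L) at_top"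
proof -
  have "((\<lambda>i. f (int (nat i))) \<longlongrightarrow> L) at_top"
    by (rule filterlim_compose[OF assms filterlim_nat_sequentially])
  then show ?thesis
    by (rule Lim_transform_eventually) (auto intro!: eventually_at_top_linorderI[of 0])
qed

lemma tendsto_int_at_bot:
  fixes f :: "int \<Rightarrow> complex"
  assumes "(\<lambda>n. f (- int n)) \<longlonglongrightarrow> L"
  shows "(f \<longlongrightarrow> L) at_bot"
  unfolding at_bot_mirror filterlim_filtermap using assms by (rule tendsto_int_at_top)

text \<open>The integer s stands for the sign of the ray. Summability and integrability are asserted
  next to the identities because infinite sums and integrals have default values when they do not
  converge.\<close>

theorem mainTheorem2:
  fixes t' lam' lam t Q q :: complex and \<rho> :: "int \<Rightarrow> complex"
  assumes "Im t' > 0"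
    and "\<And>k. \<rho> k \<in> sector (l_dir t' k) (l_dir t' (k - 1))"
    and "lam = 2 * of_real pi / lam'" and "t = t' / lam'"
    and "Q = exp (2 * of_real pi * \<i> * t)" and "q = exp (\<i> * lam)"
  shows
    "(\<forall>s\<in>{1, -1::int}. \<forall>k. lam' \<in> half_plane (of_int s * \<rho> k) \<longrightarrow>
        (\<forall>v\<in>ray (of_int s * \<rho> k). Gs_term v t' summable_on UNIV - {0}) \<and>
        ray_integrable (of_int s * \<rho> k) (\<lambda>v. exp (- v / lam') * Gs v t'))
   \<and> (\<forall>s\<in>{1, -1::int}. \<forall>k.
        lam' \<in> half_plane (of_int s * \<rho> (k + 1)) \<inter> half_plane (of_int s * \<rho> k) \<longrightarrow>
        F' (of_int s * \<rho> (k + 1)) lam' t' - F' (of_int s * \<rho> k) lam' t'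
          = - of_int s * of_int k * Ln (1 - Q powi s * q powi (s * k)))
   \<and> (\<forall>s\<in>{1, -1::int}.
        lam' \<in> half_plane (of_int s * \<rho> 1) \<inter> half_plane (of_int s * \<rho> 0) \<longrightarrow>
        F' (of_int s * \<rho> 1) lam' t' = F' (of_int s * \<rho> 0) lam' t')
   \<and> (0 < Re t' \<and> Re t' < 1 \<and> Im lam' > 0 \<and> (\<forall>k\<le>0. lam' \<in> half_plane (\<rho> k)) \<longrightarrow>
        summable (\<lambda>k. of_nat (Suc k) * Ln (1 - Q * q powi (- int (Suc k)))) \<and>
        summable (\<lambda>k. 1 / of_nat (Suc k) *
          (exp (2 * of_real pi * \<i> * of_nat (Suc k) * t) / (2 * sin (of_nat (Suc k) * lam / 2)) ^ 2)) \<and>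
        ((\<lambda>k. F' (\<rho> k) lam' t' - F' (\<rho> 0) lam' t') \<longlongrightarrow>
          - (\<Sum>k. of_nat (Suc k) * Ln (1 - Q * q powi (- int (Suc k))))) at_bot \<and>
        - (\<Sum>k. of_nat (Suc k) * Ln (1 - Q * q powi (- int (Suc k))))
          = - (\<Sum>k. 1 / of_nat (Suc k) *
          (exp (2 * of_real pi * \<i> * of_nat (Suc k) * t) / (2 * sin (of_nat (Suc k) * lam / 2)) ^ 2)))
   \<and> (0 < Re t' \<and> Re t' < 1 \<and> Im lam' < 0 \<and> (\<forall>k\<ge>0. lam' \<in> half_plane (\<rho> k)) \<longrightarrow>
        summable (\<lambda>k. of_nat (Suc k) * Ln (1 - Q * q powi int (Suc k))) \<and>
        summable (\<lambda>k. 1 / of_nat (Suc k) *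
          (exp (2 * of_real pi * \<i> * of_nat (Suc k) * t) / (2 * sin (of_nat (Suc k) * lam / 2)) ^ 2)) \<and>
        ((\<lambda>k. F' (\<rho> k) lam' t' - F' (\<rho> 0) lam' t') \<longlongrightarrow>
          - (\<Sum>k. of_nat (Suc k) * Ln (1 - Q * q powi int (Suc k)))) at_top \<and>
        - (\<Sum>k. of_nat (Suc k) * Ln (1 - Q * q powi int (Suc k)))
          = - (\<Sum>k. 1 / of_nat (Suc k) *
          (exp (2 * of_real pi * \<i> * of_nat (Suc k) * t) / (2 * sin (of_nat (Suc k) * lam / 2)) ^ 2)))"
    (is "?integrable \<and> ?jump \<and> ?no_jump \<and> (_ \<and> _ \<and> ?upper \<longrightarrow> ?limit_bot) \<and> (_ \<and> _ \<and> ?lower \<longrightarrow> ?limit_top)")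
proof -
  note t' = assms(1) and \<rho> = assms(2) and lam = assms(3) and t = assms(4) and Q = assms(5) and q = assms(6)
  have \<rho>': "\<rho> (k + 1) \<in> sector (l_dir t' (k + 1)) (l_dir t' k)" for k
    using \<rho>[of "k + 1"] by simp
  \<comment> \<open>The passage to the variables t and lam: -s l'_k / lam' equals s (2 pi i t) + s k
    (i lam).\<close>
  have X: "exp (- (of_int s * l_dir t' k) / lam') = Q powi s * q powi (s * k)" for s k :: int
  proof -
    have "- (of_int s * l_dir t' k) / lam' = of_int s * (2 * of_real pi * \<i> * t) + of_int (s * k) * (\<i> * lam)"
      by (simp add: l_dir_def t lam add_divide_distrib algebra_simps)
    then show ?thesis by (simp only: Q q exp_power_int exp_add)
  qed
  have sabs: "\<bar>s\<bar> = 1" if "s \<in> {1, -1::int}" for s using that by auto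
  have jump: "F' (of_int s * \<rho> (k + 1)) lam' t' - F' (of_int s * \<rho> k) lam' t'
          = - of_int s * of_int k * Ln (1 - Q powi s * q powi (s * k))"
    if "s \<in> {1, -1::int}" "lam' \<in> half_plane (of_int s * \<rho> (k + 1))" "lam' \<in> half_plane (of_int s * \<rho> k)" for s k
    unfolding X[symmetric] by (rule F'_jump[OF t' \<rho> \<rho>' sabs[OF that(1)] that(3,2)])
  have jump1: "F' (\<rho> (k + 1)) lam' t' - F' (\<rho> k) lam' t' = - of_int k * Ln (1 - Q * q powi k)"
    if "lam' \<in> half_plane (\<rho> (k + 1))" "lam' \<in> half_plane (\<rho> k)" for k
    using jump[of 1 k] that by simp
  have norm1: "norm (Q * q powi k) < 1"
    if "lam' \<in> half_plane (\<rho> (k + 1))" "lam' \<in> half_plane (\<rho> k)" for k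
    using norm_exp_l_dir_less_1[OF t' \<rho> \<rho>', of lam' 1 k] that unfolding X by simp
  have ?integrable
    using Gs_ray_sums(1,2)[OF t' \<rho> sabs] by blast
  moreover have ?jump
    using jump by blast
  moreover have ?no_jump
    using jump[of _ 0] by auto
  moreover have ?limit_bot if upper: ?upper
  proof -
    have hp: "lam' \<in> half_plane (\<rho> k)" if "k \<le> 0" for k using upper that by blast
    \<comment> \<open>Inversion flips the sign of the imaginary part, so here 1/q is the variable of
      norm below 1.\<close>
    have Imq: "Im lam < 0"
      using upper unfolding lam by (auto simp: Im_divide mult_neg_pos divide_neg_pos sum_power2_gt_zero_iff)
    let ?x = "exp (- (\<i> * lam))"
    have qx: "q powi (- int m) = ?x ^ m" for m
      unfolding q exp_power_int by (simp add: exp_of_nat_mult[symmetric])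
    have "norm ?x < 1" using Imq by (simp add: norm_exp_eq_Re)
    moreover have "norm (Q * ?x) < 1"
      using norm1[of "-1"] qx[of 1] hp[of 0] hp[of "-1"] by simp
    ultimately obtain S where S: "(\<lambda>m. of_nat (Suc m) * Ln (1 - Q * q powi (- int (Suc m)))) sums S"
      "(\<lambda>k. 1 / of_nat (Suc k) *
        (exp (2 * of_real pi * \<i> * of_nat (Suc k) * t) / (2 * sin (of_nat (Suc k) * lam / 2)) ^ 2)) sums S"
      unfolding qx Q using stokes_sum_eq_sin_sum[of ?x lam t] by blast
    have "F' (\<rho> (- int n)) lam' t' - F' (\<rho> 0) lam' t'
        = - (\<Sum>m<n. of_nat (Suc m) * Ln (1 - Q * q powi (- int (Suc m))))" for n
    proof (induction n)
      case (Suc n)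
      \<comment> \<open>The jump at index -(n + 1) leads from the ray of that index up to the one of
        index -n. Telescoping downwards therefore reverses it, and the ray l'_0 is never
        crossed.\<close>
      have "F' (\<rho> (- int n)) lam' t' - F' (\<rho> (- int (Suc n))) lam' t'
        = of_nat (Suc n) * Ln (1 - Q * q powi (- int (Suc n)))"
        using jump1[of "- int (Suc n)"] hp[of "- int n"] hp[of "- int (Suc n)"] by simp
      with Suc show ?case by (simp only: sum.lessThan_Suc) (simp add: algebra_simps)
    qed simp
    then have "((\<lambda>k. F' (\<rho> k) lam' t' - F' (\<rho> 0) lam' t') \<longlongrightarrow> - S) at_bot"
      by (intro tendsto_int_at_bot) (simp only: tendsto_minus S(1)[unfolded sums_def])
    then show ?thesis using S by (simp only: sums_iff simp_thms)
  qed
  moreover have ?limit_top if lower: ?lower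
  proof -
    have hp: "lam' \<in> half_plane (\<rho> k)" if "k \<ge> 0" for k using lower that by blast
    have Imq: "Im lam > 0"
      using lower unfolding lam
      by (auto simp: Im_divide sum_power2_gt_zero_iff intro!: divide_neg_pos mult_pos_neg)
    let ?x = "exp (\<i> * lam)"
    have qx: "q powi (int m) = ?x ^ m" for m
      unfolding q by simp
    have "norm ?x < 1" using Imq by (simp add: norm_exp_eq_Re)
    moreover have "norm (Q * ?x) < 1"
      using norm1[of "1"] qx[of 1] hp[of 1] hp[of "2"] by simp
    ultimately obtain S where S: "(\<lambda>m. of_nat (Suc m) * Ln (1 - Q * q powi int (Suc m))) sums S"
      "(\<lambda>k. 1 / of_nat (Suc k) *
        (exp (2 * of_real pi * \<i> * of_nat (Suc k) * t) / (2 * sin (of_nat (Suc k) * lam / 2)) ^ 2)) sums S"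
      unfolding qx Q using stokes_sum_eq_sin_sum[of ?x lam t] by blast
    \<comment> \<open>Going upwards, the rays crossed are l'_0 to l'_(n-1), so this sum starts at
      the index 0 and not at 1 as in the other direction.\<close>
    have "F' (\<rho> (int n)) lam' t' - F' (\<rho> 0) lam' t'
        = - (\<Sum>m<n. of_nat m * Ln (1 - Q * q powi int m))" for n
    proof (induction n)
      case (Suc n)
      have "F' (\<rho> (int (Suc n))) lam' t' - F' (\<rho> (int n)) lam' t'
        = - (of_nat n * Ln (1 - Q * q powi int n))"
        using jump1[of "int n"] hp[of "int n"] hp[of "int (Suc n)"] by (simp add: add.commute)
      moreover have "F' (\<rho> (int (Suc n))) lam' t' - F' (\<rho> 0) lam' t'
          = (F' (\<rho> (int (Suc n))) lam' t' - F' (\<rho> (int n)) lam' t') + (F' (\<rho> (int n)) lam' t' - F' (\<rho> 0) lam' t')"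
        by simp
      ultimately show ?case by (simp only: Suc sum.lessThan_Suc minus_add_distrib add.commute)
    qed simp
    \<comment> \<open>The term m = 0 vanishes, which reconciles this indexing with the series
      starting at 1.\<close>
    moreover have "(\<lambda>m. of_nat m * Ln (1 - Q * q powi int m)) sums S"
      using S(1) sums_Suc_iff[of "\<lambda>m. of_nat m * Ln (1 - Q * q powi int m)" S] by simp
    ultimately have "((\<lambda>k. F' (\<rho> k) lam' t' - F' (\<rho> 0) lam' t') \<longlongrightarrow> - S) at_top"
      by (intro tendsto_int_at_top) (simp only: tendsto_minus sums_def)
    then show ?thesis using S by (simp only: sums_iff simp_thms)
  qed
  ultimately show ?thesis by blast
qed

end
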